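(* There is an absolute constant $c>0$ and, for all $n,m\in\mathbb{N}$, a constant $C_{n,m}>0$ such that the following holds. Let $\mathbf{G}$ be an abelian group, $A\subseteq\mathbf{G}$ a nonempty finite set, $D\subseteq A-A$ a set with $D=-D$, and $\eta\in(0,1]$ a real number with $$\sum_{x\in D}(A\circ A)(x)=\eta|A|^2,$$ and define $M$ by $\mathsf{E}_3(A)=\eta^3M|A|^6/|D|^2$. Then there is a set $A'\subseteq A$ such that $$|A'|\ge c\,\frac{\eta^{16}|A|}{M^5}$$ and $$|nA'-mA'|\le C_{n,m}\left(\frac{\eta^{15}}{M^5}\right)^{-7(n+m)}\frac{|D|}{\eta|A|}\cdot|A'|$$ for every $n,m\in\mathbb{N}$.
   Context: $A-A=\{a-b:a,b\in A\}$. $(A\circ A)(x)=|\{(a,a')\in A\times A:a'-a=x\}|$ for $x\in\mathbf{G}$, and $\mathsf{E}_3(A)=\sum_x(A\circ A)(x)^3$. $nA'-mA'$ denotes the set of all $a_1+\dots+a_n-b_1-\dots-b_m$ with $a_i,b_j\in A'$. $\mathbb{N}$ is the set of positive integers. *)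

theory Defs
  imports Complex_Main "HOL-Algebra.Algebra"
begin

text \<open>
  Abelian groups are HOL-Algebra's (multiplicatively written) structures
  \<^const>\<open>comm_group\<close>: the sum $a + b$ is \<open>a \<otimes> b\<close>, the difference $a - b$ is \<open>a \<otimes> inv b\<close>,
  the difference set $A - A$ is \<open>A <#> set_inv A\<close>, and $-D$ is \<open>set_inv D\<close>.
\<close>

definition diff_count :: "('a, 'b) monoid_scheme \<Rightarrow> 'a set \<Rightarrow> 'a \<Rightarrow> nat" where
  "diff_count G A x = card {(a, a') \<in> A \<times> A. a' \<otimes>\<^bsub>G\<^esub> inv\<^bsub>G\<^esub> a = x}"

text \<open>
  The sum over all \<open>x\<close> in the group is taken over the support of the summand, which is finite
  for finite \<open>A\<close>; \<^const>\<open>sum\<close> over an infinite carrier would be \<open>0\<close>.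
\<close>

definition energy3 :: "('a, 'b) monoid_scheme \<Rightarrow> 'a set \<Rightarrow> nat" where
  "energy3 G A = (\<Sum>x | x \<in> carrier G \<and> diff_count G A x \<noteq> 0. diff_count G A x ^ 3)"

definition sum_diff_set :: "('a, 'b) monoid_scheme \<Rightarrow> nat \<Rightarrow> nat \<Rightarrow> 'a set \<Rightarrow> 'a set" where
  "sum_diff_set G n m A =
     {finprod G a {..<n} \<otimes>\<^bsub>G\<^esub> inv\<^bsub>G\<^esub> finprod G b {..<m} | a b.
        a \<in> {..<n} \<rightarrow> A \<and> b \<in> {..<m} \<rightarrow> A}"

text \<open>
  The constants \<open>c\<close> and \<open>C\<close> have to be absolute. HOL cannot quantify over types inside a formula,
  and constants bound existentially in front of ``all groups on \<open>'a\<close>'' could depend on \<open>'a\<close>. The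
  theorem therefore asserts that there are constants serving every abelian group on \<^typ>\<open>nat\<close>, and
  that any such constants, chosen without reference to \<open>'a\<close>, serve every abelian group on \<open>'a\<close>.
\<close>

definition structured_subsets ::
  "('a, 'b) monoid_scheme \<Rightarrow> real \<Rightarrow> (nat \<Rightarrow> nat \<Rightarrow> real) \<Rightarrow> bool" where
  "structured_subsets G c C \<longleftrightarrow>
     (\<forall>A D. \<forall>\<eta> M :: real.
        A \<subseteq> carrier G \<and> finite A \<and> A \<noteq> {} \<and>
        D \<subseteq> A <#>\<^bsub>G\<^esub> set_inv\<^bsub>G\<^esub> A \<and> D = set_inv\<^bsub>G\<^esub> D \<and>
        0 < \<eta> \<and> \<eta> \<le> 1 \<and>
        real (\<Sum>x\<in>D. diff_count G A x) = \<eta> * real (card A) ^ 2 \<and>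
        real (energy3 G A) = \<eta> ^ 3 * M * real (card A) ^ 6 / real (card D) ^ 2
        \<longrightarrow>
        (\<exists>A' \<subseteq> A.
           real (card A') \<ge> c * (\<eta> ^ 16 * real (card A) / M ^ 5) \<and>
           (\<forall>n\<ge>1. \<forall>m\<ge>1.
              real (card (sum_diff_set G n m A')) \<le>
                C n m * (\<eta> ^ 15 / M ^ 5) powi (- (7 * (int n + int m)))
                * (real (card D) / (\<eta> * real (card A))) * real (card A'))))"

end

theory Submission
  imports Defs "HOL-Analysis.Convex"
begin

text \<open>
  Write \<open>N = |A|\<close>, \<open>d = |D|\<close>, \<open>r = A \<circ> A\<close>, and let \<open>S\<close> be the set of \<open>x \<in> D\<close> with \<open>r(x) \<ge> \<eta>N\<^sup>2/(2d)\<close>.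
  By Cauchy--Schwarz the triples \<open>a, b, c \<in> A\<close> with \<open>a - b, c - b \<in> S\<close>, weighted by \<open>r(a - c)\<close>, have total
  weight at least \<open>\<eta>\<^sup>4N\<^sup>5/(16d)\<close>. The third energy limits the contribution of very popular \<open>a - c\<close>, so
  many triples have \<open>a - c\<close> in a set \<open>P\<close> of popular differences with \<open>|P| \<le> 64d/\<eta>\<^sup>4\<close>. Since the number of
  \<open>b\<close> giving the same pair \<open>(a - b, c - b)\<close> has second moment at most the third energy, a proportion
  \<open>\<delta> = \<eta>\<^sup>7/(2\<^sup>2\<^sup>2M\<^sup>3)\<close> of the pairs in \<open>S \<times> S\<close> have their difference in \<open>P\<close>. Dependent random choice turns
  this into \<open>U \<subseteq> S\<close> with \<open>|U| \<ge> \<delta>d/4\<close> and \<open>|U - U|\<close> at most a constant times \<open>\<eta>\<^sup>-\<^sup>5\<^sup>8M\<^sup>1\<^sup>8|U|\<close>. As all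
  elements of \<open>U\<close> are popular, some translate of \<open>U\<close> contains a subset \<open>B\<close> of \<open>A\<close> with
  \<open>|B| \<ge> \<eta>N|U|/(2d)\<close>, and the Pluennecke--Ruzsa inequality for \<open>B\<close> and \<open>-U\<close> bounds \<open>nB - mB\<close>; the exponents
  are compared by means of \<open>\<eta> \<le> 1 \<le> M\<close>.

  Absolute constants on \<open>nat\<close> serve all types because a finite \<open>A\<close> generates a countable subgroup, which has a
  copy on \<open>nat\<close>.
\<close>

section \<open>Sumsets: Ruzsa's triangle inequality, Petridis's lemma and the Pluennecke-Ruzsa
  inequality\<close>

section \<open>Sumset inequalities\<close>

context comm_group
begin

lemma set_mult_image: "U <#> Y = (\<lambda>(x, y). x \<otimes> y) ` (U \<times> Y)"
  by (auto simp: set_mult_def)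

lemma finite_set_mult [simp]: "finite U \<Longrightarrow> finite Y \<Longrightarrow> finite (U <#> Y)"
  by (simp add: set_mult_image)

lemma set_inv_closed: "U \<subseteq> carrier G \<Longrightarrow> set_inv U \<subseteq> carrier G"
  by (auto simp: SET_INV_def)

lemma set_inv_image: "set_inv U = m_inv G ` U"
  by (auto simp: SET_INV_def)

lemma card_set_inv: "U \<subseteq> carrier G \<Longrightarrow> card (set_inv U) = card U"
  unfolding set_inv_image by (intro card_image inj_onI) (metis inv_inv subsetD)

lemma set_mult_comm: "U \<subseteq> carrier G \<Longrightarrow> Y \<subseteq> carrier G \<Longrightarrow> U <#> Y = Y <#> U"
  by (auto simp: set_mult_def) (metis m_comm subsetD)+

lemma card_translate: "U \<subseteq> carrier G \<Longrightarrow> c \<in> carrier G \<Longrightarrow> card (U #> c) = card U"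
  unfolding r_coset_def UNION_singleton_eq_range
  by (intro card_image inj_onI) (metis right_cancel subsetD)

lemma finite_translate: "finite U \<Longrightarrow> finite (U #> c)"
  by (simp add: r_coset_def)

text \<open>Every difference \<open>w\<close> gets one fixed representation
  \<open>w = y - z\<close>, supplied by \<open>p\<close>. The map from \<open>(x, w)\<close> to
  \<open>(x + y, x + z)\<close> is injective: the difference of the two coordinates returns
  \<open>w\<close>, hence \<open>y\<close> and \<open>z\<close>, and cancellation then returns
  \<open>x\<close>.\<close>

lemma ruzsa_triangle:
  assumes "finite U" "finite Y" "finite Z"
    and "U \<subseteq> carrier G" "Y \<subseteq> carrier G" "Z \<subseteq> carrier G"
  shows "card U * card (Y <#> set_inv Z) \<le> card (U <#> Y) * card (U <#> Z)"
proof -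
  have "\<forall>w \<in> Y <#> set_inv Z. \<exists>p. fst p \<in> Y \<and> snd p \<in> Z \<and> w = fst p \<otimes> inv (snd p)"
    by (auto simp: set_mult_def SET_INV_def)
  then obtain p where p: "\<And>w. w \<in> Y <#> set_inv Z \<Longrightarrow>
      fst (p w) \<in> Y \<and> snd (p w) \<in> Z \<and> w = fst (p w) \<otimes> inv (snd (p w))"
    by metis
  let ?f = "\<lambda>(x, w). (x \<otimes> fst (p w), x \<otimes> snd (p w))"
  have inj: "inj_on ?f (U \<times> (Y <#> set_inv Z))"
  proof (rule inj_onI, clarify)
    fix x w x' w'
    assume x: "x \<in> U" "x' \<in> U" and w: "w \<in> Y <#> set_inv Z" "w' \<in> Y <#> set_inv Z"
      and eq: "x \<otimes> fst (p w) = x' \<otimes> fst (p w')" "x \<otimes> snd (p w) = x' \<otimes> snd (p w')"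
    have diff: "(u \<otimes> y) \<otimes> inv (u \<otimes> z) = y \<otimes> inv z"
      if "u \<in> carrier G" "y \<in> carrier G" "z \<in> carrier G" for u y z
    proof -
      have "(u \<otimes> y) \<otimes> inv (u \<otimes> z) = (u \<otimes> inv u) \<otimes> (y \<otimes> inv z)"
        unfolding inv_mult[OF that(1,3)] using that by (simp only: m_ac inv_closed m_closed)
      then show ?thesis using that by simp
    qed
    have c: "x \<in> carrier G" "x' \<in> carrier G"
        "fst (p w) \<in> carrier G" "snd (p w) \<in> carrier G"
        "fst (p w') \<in> carrier G" "snd (p w') \<in> carrier G"
      using x p[OF w(1)] p[OF w(2)] assms by auto
    have ww: "w = w'"
      using p[OF w(1)] p[OF w(2)] eq diff[OF c(1,3,4)] diff[OF c(2,5,6)] by metis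
    with eq c show "x = x' \<and> w = w'"
      by simp
  qed
  have "?f ` (U \<times> (Y <#> set_inv Z)) \<subseteq> (U <#> Y) \<times> (U <#> Z)"
    using p by (fastforce simp: set_mult_def)
  from card_inj_on_le[OF inj this] assms show ?thesis
    by (simp add: card_cartesian_product)
qed

text \<open>Petridis's lemma. By \<open>K\<close> and \<open>min\<close>, \<open>U\<close> has the
  least growth ratio among its own nonempty subsets. Hence \<open>C\<close> can be built up one
  element at a time, each step enlarging \<open>U + B + C\<close> by at most \<open>K\<close> times
  what it adds to \<open>U + C\<close>.\<close>

lemma petridis:
  fixes K :: real
  assumes U: "finite U" "U \<noteq> {}" "U \<subseteq> carrier G" and B: "finite B" "B \<subseteq> carrier G"
    and K: "card (U <#> B) = K * card U"
    and min: "\<And>Z. Z \<subseteq> U \<Longrightarrow> K * card Z \<le> card (Z <#> B)"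
    and C: "finite C" "C \<subseteq> carrier G"
  shows "card (U <#> B <#> C) \<le> K * card (U <#> C)"
  using C
proof (induction C rule: finite_induct)
  case empty
  then show ?case by (simp add: set_mult_def)
next
  case (insert c C)
  have c: "c \<in> carrier G" and C: "C \<subseteq> carrier G" using insert by auto
  have K0: "K \<ge> 0"
    using K U by (metis card_gt_0_iff mult_less_0_iff not_less of_nat_0_le_iff of_nat_0_less_iff)
  have XB: "U <#> B \<subseteq> carrier G" using U B set_mult_closed by simp
  define Z where "Z = {x \<in> U. ({x} <#> B) #> c \<subseteq> U <#> B <#> C}"
  define W where "W = {x \<in> U. x \<otimes> c \<in> U <#> C}"
  have ZX: "Z \<subseteq> U" and WX: "W \<subseteq> U" by (auto simp: Z_def W_def)
  have fin: "finite Z" "finite W" using finite_subset[OF ZX] finite_subset[OF WX] U(1) by auto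
  \<comment> \<open>The new sums \<open>U + B + c\<close> miss \<open>Z + B + c\<close>, which already lies in \<open>U + B + C\<close>; minimality of the
    ratio bounds \<open>Z + B\<close> from below, and \<open>W \<subseteq> Z\<close> matches the number of new elements of \<open>U + C\<close>.\<close>
  have WZ: "W \<subseteq> Z"
  proof
    fix x assume x: "x \<in> W"
    then have xX: "x \<in> U" and "x \<otimes> c \<in> U <#> C" by (auto simp: W_def)
    then obtain x' c' where x': "x' \<in> U" "c' \<in> C" "x \<otimes> c = x' \<otimes> c'"
      by (auto simp: set_mult_def)
    have "x \<otimes> b \<otimes> c \<in> U <#> B <#> C" if b: "b \<in> B" for b
    proof -
      have car: "x \<in> carrier G" "x' \<in> carrier G" "b \<in> carrier G" "c' \<in> carrier G"
        using xX x' b U B C by auto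
      have "x \<otimes> b \<otimes> c = (x \<otimes> c) \<otimes> b" using car c by (simp add: m_ac)
      also have "\<dots> = (x' \<otimes> b) \<otimes> c'" using car c x' by (simp add: m_ac)
      finally show ?thesis using x' b by (auto simp: set_mult_def)
    qed
    then have "({x} <#> B) #> c \<subseteq> U <#> B <#> C"
      unfolding r_coset_def set_mult_def[of G "{x}" B] by blast
    then show "x \<in> Z" using xX unfolding Z_def by blast
  qed
  have ZB: "(Z <#> B) #> c \<subseteq> U <#> B <#> C"
  proof
    fix w assume "w \<in> (Z <#> B) #> c"
    then obtain z b where z: "z \<in> Z" and b: "b \<in> B" and w: "w = z \<otimes> b \<otimes> c"
      by (auto simp: r_coset_def set_mult_def)
    then have "w \<in> ({z} <#> B) #> c" by (auto simp: r_coset_def set_mult_def)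
    with z show "w \<in> U <#> B <#> C" unfolding Z_def by blast
  qed
  have ZBXB: "(Z <#> B) #> c \<subseteq> (U <#> B) #> c"
    using mono_set_mult[OF ZX order_refl, of G B] unfolding r_coset_def by blast
  have "U <#> B <#> insert c C \<subseteq> (U <#> B <#> C) \<union> (((U <#> B) #> c) - ((Z <#> B) #> c))"
    unfolding set_mult_def[of G "U <#> B" "insert c C"] set_mult_def[of G "U <#> B" C]
      r_coset_def[of G "U <#> B"]
    using ZB[unfolded set_mult_def[of G "U <#> B" C]] by blast
  then have "card (U <#> B <#> insert c C)
      \<le> card ((U <#> B <#> C) \<union> (((U <#> B) #> c) - ((Z <#> B) #> c)))"
    using U B insert by (intro card_mono) (auto intro!: finite_translate)
  also have "\<dots> \<le> card (U <#> B <#> C) + card (((U <#> B) #> c) - ((Z <#> B) #> c))"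
    by (rule card_Un_le)
  also have "card (((U <#> B) #> c) - ((Z <#> B) #> c)) = card (U <#> B) - card (Z <#> B)"
    using ZBXB fin U B c XB ZX
    by (subst card_Diff_subset) (auto simp: finite_translate card_translate set_mult_closed subset_trans[OF ZX])
  finally have "real (card (U <#> B <#> insert c C))
      \<le> card (U <#> B <#> C) + (real (card (U <#> B)) - card (Z <#> B))"
    using card_mono[of "U <#> B" "Z <#> B"] U B mono_set_mult[OF ZX order_refl, of G B] by simp
  also have "\<dots> \<le> K * card (U <#> C) + (K * card U - K * card Z)"
    using insert.IH[OF C] K min[OF ZX] by linarith
  also have "\<dots> \<le> K * card (U <#> C) + (K * card U - K * card W)"
    using card_mono[OF fin(1) WZ] K0 by (simp add: mult_left_mono)
  also have "\<dots> = K * (card (U <#> C) + (real (card U) - card W))"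
    by (simp add: algebra_simps)
  also have "card (U <#> C) + (real (card U) - card W) = card (U <#> insert c C)"
  proof -
    have eq: "U <#> insert c C = (U <#> C) \<union> ((U - W) #> c)"
      unfolding W_def r_coset_def set_mult_def by blast
    have "(U <#> C) \<inter> ((U - W) #> c) = {}"
      by (auto simp: W_def r_coset_def)
    then have "card (U <#> insert c C) = card (U <#> C) + card ((U - W) #> c)"
      unfolding eq using U insert by (intro card_Un_disjoint) (auto intro!: finite_translate)
    also have "card ((U - W) #> c) = card U - card W"
      using U c fin WX by (subst card_translate) (auto simp: card_Diff_subset)
    finally show ?thesis using card_mono[OF U(1) WX] by simp
  qed
  finally show ?case .
qed

text \<open>The summand \<open>B\<close> is split off on the left, so that adding \<open>Y\<close>
  in front reassociates to \<open>Y + B + iterated_sum k B\<close>, the shape treated by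
  \<open>petridis\<close>.\<close>

fun iterated_sum :: "nat \<Rightarrow> 'a set \<Rightarrow> 'a set" where
  "iterated_sum 0 B = {\<one>}"
| "iterated_sum (Suc n) B = B <#> iterated_sum n B"

lemma iterated_sum_closed: "B \<subseteq> carrier G \<Longrightarrow> iterated_sum n B \<subseteq> carrier G"
  by (induction n) (auto simp: set_mult_closed)

lemma finite_iterated_sum: "finite B \<Longrightarrow> finite (iterated_sum n B)"
  by (induction n) auto

lemma finprod_in_iterated_sum:
  assumes "B \<subseteq> carrier G" "a \<in> {..<n} \<rightarrow> B"
  shows "finprod G a {..<n} \<in> iterated_sum n B"
  using assms(2)
proof (induction n)
  case (Suc n)
  have a: "a \<in> {..<n} \<rightarrow> B" "a n \<in> B" "a \<in> {..<n} \<rightarrow> carrier G" "a n \<in> carrier G"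
    using Suc.prems assms(1) by (auto simp: lessThan_Suc)
  then have "finprod G a {..<Suc n} = a n \<otimes> finprod G a {..<n}"
    by (simp add: lessThan_Suc finprod_insert)
  then show ?case using a Suc.IH by (auto simp: set_mult_def)
qed simp

lemma sum_diff_set_subset:
  assumes "B \<subseteq> carrier G"
  shows "sum_diff_set G n m B \<subseteq> iterated_sum n B <#> set_inv (iterated_sum m B)"
proof
  fix w assume "w \<in> sum_diff_set G n m B"
  then obtain a b where "a \<in> {..<n} \<rightarrow> B" "b \<in> {..<m} \<rightarrow> B"
    and w: "w = finprod G a {..<n} \<otimes> inv finprod G b {..<m}"
    by (auto simp: sum_diff_set_def)
  then have "finprod G a {..<n} \<in> iterated_sum n B" "finprod G b {..<m} \<in> iterated_sum m B"
    using finprod_in_iterated_sum[OF assms] by auto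
  then show "w \<in> iterated_sum n B <#> set_inv (iterated_sum m B)"
    unfolding w set_mult_def SET_INV_def by blast
qed

text \<open>Among the nonempty subsets of \<open>U\<close>, one with least growth ratio
  \<open>L \<le> K\<close> is chosen. \<open>petridis\<close>, applied once per summand, bounds
  \<open>Y + kB\<close> by \<open>L ^ k * |Y|\<close>, and the triangle inequality with pivot
  \<open>Y\<close> combines the bounds for \<open>nB\<close> and \<open>mB\<close>.\<close>

lemma pluennecke_ruzsa:
  fixes K :: real
  assumes U: "finite U" "U \<noteq> {}" "U \<subseteq> carrier G" and B: "finite B" "B \<subseteq> carrier G"
    and K: "card (U <#> B) \<le> K * card U"
  shows "card (sum_diff_set G n m B) \<le> K ^ (n + m) * card U"
proof -
  define ratio where "ratio = (\<lambda>Z. real (card (Z <#> B)) / card Z)"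
  define F where "F = Pow U - {{}}"
  have F: "finite F" "U \<in> F" using U by (auto simp: F_def)
  obtain Y where Y: "Y \<in> F" and min: "\<And>Z. Z \<in> F \<Longrightarrow> ratio Y \<le> ratio Z"
  proof (rule that[of "arg_min_on ratio F"])
    show "arg_min_on ratio F \<in> F" using F by (intro arg_min_if_finite) auto
    show "ratio (arg_min_on ratio F) \<le> ratio Z" if "Z \<in> F" for Z
      using F that by (intro arg_min_least) auto
  qed
  have Yp: "finite Y" "Y \<noteq> {}" "Y \<subseteq> carrier G" "Y \<subseteq> U"
    using Y U finite_subset by (auto simp: F_def)
  define L where "L = ratio Y"
  have L0: "L \<ge> 0" by (simp add: L_def ratio_def)
  have "L \<le> ratio U" using min F by (simp add: L_def)
  also have "\<dots> \<le> K" using K U by (simp add: ratio_def field_simps card_gt_0_iff)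
  finally have LK: "L \<le> K" .
  have LY: "card (Y <#> B) = L * card Y" using Yp by (simp add: L_def ratio_def)
  \<comment> \<open>The family \<open>F\<close> omits the empty set, on which \<open>ratio\<close>
    would be a division by zero, so that the trivial case is split off.\<close>
  have Lmin: "L * card Z \<le> card (Z <#> B)" if "Z \<subseteq> Y" for Z
  proof (cases "Z = {}")
    case False
    then have "card Z > 0" using that Yp(1) finite_subset by (auto simp: card_gt_0_iff)
    moreover have "L \<le> ratio Z" using min[of Z] False that Yp by (auto simp: L_def F_def)
    ultimately show ?thesis by (simp add: ratio_def field_simps)
  qed simp
  have iter: "card (Y <#> iterated_sum k B) \<le> L ^ k * card Y" for k
  proof (induction k)
    case 0
    have "Y <#> {\<one>} = Y" using Yp(3) by (force simp: set_mult_def)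
    then show ?case by simp
  next
    case (Suc k)
    have "card (Y <#> iterated_sum (Suc k) B) = card (Y <#> B <#> iterated_sum k B)"
      using Yp B iterated_sum_closed[OF B(2)] by (simp add: set_mult_assoc)
    also have "\<dots> \<le> L * card (Y <#> iterated_sum k B)"
      using petridis[OF Yp(1-3) B LY Lmin] finite_iterated_sum[OF B(1)] iterated_sum_closed[OF B(2)]
      by blast
    also have "\<dots> \<le> L * (L ^ k * card Y)"
      using Suc L0 by (intro mult_left_mono)
    finally show ?case by simp
  qed
  have fB: "finite (iterated_sum k B)" "iterated_sum k B \<subseteq> carrier G" for k
    using finite_iterated_sum[OF B(1)] iterated_sum_closed[OF B(2)] by auto
  have Y0: "real (card Y) > 0" using Yp by (simp add: card_gt_0_iff)
  have "card (sum_diff_set G n m B) \<le> card (iterated_sum n B <#> set_inv (iterated_sum m B))"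
    using fB by (intro card_mono sum_diff_set_subset B) (auto simp: set_inv_image)
  \<comment> \<open>The factor \<open>|Y|\<close> demanded by the triangle inequality cancels
    against one of the two factors \<open>|Y|\<close> coming from \<open>iter\<close>.\<close>
  then have "real (card Y) * card (sum_diff_set G n m B)
      \<le> real (card Y * card (iterated_sum n B <#> set_inv (iterated_sum m B)))"
    by (simp add: mult_left_mono)
  also have "\<dots> \<le> real (card (Y <#> iterated_sum n B) * card (Y <#> iterated_sum m B))"
    using ruzsa_triangle[OF Yp(1) fB(1)[of n] fB(1)[of m] Yp(3) fB(2) fB(2)]
    by (rule of_nat_mono)
  also have "\<dots> \<le> (L ^ n * card Y) * (L ^ m * card Y)"
    unfolding of_nat_mult using L0 by (intro mult_mono iter) auto
  also have "\<dots> = real (card Y) * (L ^ (n + m) * card Y)"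
    by (simp add: power_add)
  finally have "card (sum_diff_set G n m B) \<le> L ^ (n + m) * card Y"
    using Y0 by simp
  also have "\<dots> \<le> K ^ (n + m) * card U"
    using L0 LK card_mono[OF U(1) Yp(4)] by (intro mult_mono power_mono) auto
  finally show ?thesis .
qed

end

section \<open>Counting identities for \<open>A \<circ> A\<close>, corners, and a lower bound for
  weighted 2-paths\<close>

section \<open>Difference counts and the third energy\<close>

context comm_group
begin

lemma diff_count_eq:
  assumes "A \<subseteq> carrier G" "x \<in> carrier G"
  shows "diff_count G A x = card {a \<in> A. x \<otimes> a \<in> A}"
proof -
  have eq: "a' \<otimes> inv a = x \<longleftrightarrow> a' = x \<otimes> a" if "a \<in> A" "a' \<in> A" for a a'
    using that assms by (intro inv_solve_right') auto
  have "{(a, a') \<in> A \<times> A. a' \<otimes> inv a = x} = {(a, a') \<in> A \<times> A. a' = x \<otimes> a}"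
    by (intro Collect_cong) (simp add: eq split_beta mem_Times_iff cong: conj_cong)
  also have "\<dots> = (\<lambda>a. (a, x \<otimes> a)) ` {a \<in> A. x \<otimes> a \<in> A}"
    by auto
  finally have "{(a, a') \<in> A \<times> A. a' \<otimes> inv a = x} = (\<lambda>a. (a, x \<otimes> a)) ` {a \<in> A. x \<otimes> a \<in> A}" .
  moreover have "inj_on (\<lambda>a. (a, x \<otimes> a)) {a \<in> A. x \<otimes> a \<in> A}"
    by (rule inj_onI) simp
  ultimately show ?thesis
    by (simp add: diff_count_def card_image)
qed

lemma diff_count_inv:
  assumes "A \<subseteq> carrier G" "x \<in> carrier G"
  shows "diff_count G A (inv x) = diff_count G A x"
proof -
  have swap: "a \<otimes> inv a' = inv x \<longleftrightarrow> a' \<otimes> inv a = x" if "a \<in> A" "a' \<in> A" for a a'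
  proof -
    have "a \<in> carrier G" "a' \<in> carrier G" using that assms by auto
    then have "inv (a' \<otimes> inv a) = a \<otimes> inv a'" by (simp add: inv_mult_group)
    then show ?thesis using \<open>a \<in> carrier G\<close> \<open>a' \<in> carrier G\<close> assms(2)
      by (metis inv_closed inv_inv m_closed)
  qed
  have "{(a, a') \<in> A \<times> A. a' \<otimes> inv a = inv x}
      = prod.swap ` {(a, a') \<in> A \<times> A. a' \<otimes> inv a = x}"
    using swap by (auto simp: image_iff)
  then show ?thesis
    by (simp add: diff_count_def card_image)
qed

lemma diff_set_image: "A <#> set_inv A = (\<lambda>(a, a'). a' \<otimes> inv a) ` (A \<times> A)"
  by (auto simp: set_mult_def SET_INV_def)

text \<open>The pairs are sorted by their difference; the fibre over \<open>x\<close> has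
  \<open>diff_count G A x\<close> elements, and the summand is constant on it.\<close>

lemma sum_diff_count:
  fixes f :: "'a \<Rightarrow> real"
  assumes "finite A"
  shows "(\<Sum>(a, a')\<in>A \<times> A. f (a' \<otimes> inv a)) = (\<Sum>x\<in>A <#> set_inv A. diff_count G A x * f x)"
proof -
  have "(\<Sum>(a, a')\<in>A \<times> A. f (a' \<otimes> inv a))
      = (\<Sum>x\<in>A <#> set_inv A. \<Sum>p\<in>{p \<in> A \<times> A. (case p of (a, a') \<Rightarrow> a' \<otimes> inv a) = x}.
          case p of (a, a') \<Rightarrow> f (a' \<otimes> inv a))"
    unfolding diff_set_image using assms by (intro sum.image_gen) auto
  also have "\<dots> = (\<Sum>x\<in>A <#> set_inv A. diff_count G A x * f x)"
  proof (rule sum.cong[OF refl])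
    fix x
    have "(\<Sum>p\<in>{p \<in> A \<times> A. (case p of (a, a') \<Rightarrow> a' \<otimes> inv a) = x}.
          case p of (a, a') \<Rightarrow> f (a' \<otimes> inv a))
      = (\<Sum>p\<in>{p \<in> A \<times> A. (case p of (a, a') \<Rightarrow> a' \<otimes> inv a) = x}. f x)"
      by (rule sum.cong) auto
    moreover have "{p \<in> A \<times> A. (case p of (a, a') \<Rightarrow> a' \<otimes> inv a) = x}
        = {(a, a') \<in> A \<times> A. a' \<otimes> inv a = x}"
      by auto
    ultimately show "(\<Sum>p\<in>{p \<in> A \<times> A. (case p of (a, a') \<Rightarrow> a' \<otimes> inv a) = x}.
          case p of (a, a') \<Rightarrow> f (a' \<otimes> inv a)) = diff_count G A x * f x"
      by (simp add: diff_count_def)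
  qed
  finally show ?thesis .
qed

text \<open>Both sides count the pairs in \<open>A \<times> A\<close> with difference in
  \<open>S\<close>, once by the subtracted element and once by the difference.\<close>

lemma sum_card_difference_in:
  assumes "finite A" "S \<subseteq> A <#> set_inv A"
  shows "(\<Sum>v\<in>A. real (card {a \<in> A. a \<otimes> inv v \<in> S})) = (\<Sum>x\<in>S. real (diff_count G A x))"
proof -
  define \<Delta> where "\<Delta> = A <#> set_inv A"
  have \<Delta>: "finite \<Delta>" unfolding \<Delta>_def using assms by (auto simp: set_inv_image)
  have "(\<Sum>v\<in>A. real (card {a \<in> A. a \<otimes> inv v \<in> S}))
      = (\<Sum>v\<in>A. \<Sum>a\<in>A. if a \<otimes> inv v \<in> S then 1 else 0)"
    using assms by (simp add: sum.If_cases Int_def)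
  also have "\<dots> = (\<Sum>x\<in>\<Delta>. diff_count G A x * (if x \<in> S then 1 else (0::real)))"
    unfolding \<Delta>_def using sum_diff_count[OF assms(1), of "\<lambda>x. if x \<in> S then 1 else 0"]
    by (simp add: sum.cartesian_product)
  also have "\<dots> = (\<Sum>x\<in>\<Delta>. if x \<in> S then real (diff_count G A x) else 0)"
    by (intro sum.cong) auto
  also have "\<dots> = (\<Sum>x\<in>S. real (diff_count G A x))"
    using assms(2) \<Delta> by (simp add: sum.If_cases \<Delta>_def Int_absorb1)
  finally show ?thesis .
qed

text \<open>The support of \<open>diff_count G A\<close> in the carrier is exactly the difference
  set, which turns the sum into one over an explicit finite set.\<close>

lemma energy3_eq:
  assumes "finite A" "A \<subseteq> carrier G"
  shows "energy3 G A = (\<Sum>x\<in>A <#> set_inv A. diff_count G A x ^ 3)"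
proof -
  have fin: "finite {(a, a') \<in> A \<times> A. a' \<otimes> inv a = x}" for x
    by (rule finite_subset[of _ "A \<times> A"]) (use assms in auto)
  have "{x \<in> carrier G. diff_count G A x \<noteq> 0} = A <#> set_inv A"
    unfolding diff_set_image diff_count_def card_eq_0_iff using fin assms(2) by auto
  then show ?thesis by (simp add: energy3_def)
qed

text \<open>The third energy counts a shift \<open>z\<close> together with three elements of
  \<open>A\<close> that \<open>z\<close> moves into \<open>A\<close>. Two base points
  \<open>b\<close>, \<open>b'\<close> of the same corner \<open>(x, y)\<close> give such a
  configuration: the shift \<open>b' - b\<close> and the elements \<open>b\<close>,
  \<open>x + b\<close>, \<open>y + b\<close>. The corner and both base points can be read off from
  it.\<close>

lemma sum_corners_le_energy3:
  assumes A: "finite A" "A \<subseteq> carrier G" and Q: "finite Q" "Q \<subseteq> carrier G \<times> carrier G"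
  shows "(\<Sum>(x, y)\<in>Q. (card {b \<in> A. x \<otimes> b \<in> A \<and> y \<otimes> b \<in> A})\<^sup>2) \<le> energy3 G A"
proof -
  define C where "C = (\<lambda>p. {b \<in> A. fst p \<otimes> b \<in> A \<and> snd p \<otimes> b \<in> A})"
  define R where "R = (\<lambda>z. {a \<in> A. z \<otimes> a \<in> A})"
  define \<Delta> where "\<Delta> = A <#> set_inv A"
  have \<Delta>: "finite \<Delta>" "\<Delta> \<subseteq> carrier G"
    unfolding \<Delta>_def using A by (auto simp: set_inv_image set_mult_image)
  have fin: "finite (C p)" "finite (R z)" for p z
    using A by (auto simp: C_def R_def)
  let ?L = "SIGMA p:Q. C p \<times> C p"
  let ?R = "SIGMA z:\<Delta>. R z \<times> R z \<times> R z"
  let ?f = "\<lambda>(p, b, b'). (b' \<otimes> inv b, b, fst p \<otimes> b, snd p \<otimes> b)"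
  have inj: "inj_on ?f ?L"
  proof (rule inj_onI, clarsimp)
    fix x y b b' x' y' c'
    assume h: "(x, y) \<in> Q" "(x', y') \<in> Q" "b \<in> C (x, y)" "b' \<in> C (x, y)"
      "b \<in> C (x', y')" "c' \<in> C (x', y')" "b' \<otimes> inv b = c' \<otimes> inv b"
      "x \<otimes> b = x' \<otimes> b" "y \<otimes> b = y' \<otimes> b"
    then have "x \<in> carrier G" "x' \<in> carrier G" "y \<in> carrier G" "y' \<in> carrier G"
      "b \<in> carrier G" "b' \<in> carrier G" "c' \<in> carrier G"
      using A Q by (auto simp: C_def)
    then show "x = x' \<and> y = y' \<and> b' = c'"
      using h(7-9) by simp
  qed
  have diff: "b' \<otimes> inv b \<otimes> b = b'" "b' \<otimes> inv b \<otimes> (x \<otimes> b) = x \<otimes> b'"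
    if "b \<in> carrier G" "b' \<in> carrier G" "x \<in> carrier G" for b b' x
  proof -
    show "b' \<otimes> inv b \<otimes> b = b'" using that by (simp add: m_assoc)
    have "b' \<otimes> inv b \<otimes> (x \<otimes> b) = x \<otimes> (b' \<otimes> inv b \<otimes> b)"
      using that by (simp only: m_ac inv_closed m_closed)
    then show "b' \<otimes> inv b \<otimes> (x \<otimes> b) = x \<otimes> b'" using that by (simp add: m_assoc)
  qed
  have "?f ` ?L \<subseteq> ?R"
  proof clarsimp
    fix x y b b' assume h: "(x, y) \<in> Q" "b \<in> C (x, y)" "b' \<in> C (x, y)"
    then have c: "x \<in> carrier G" "y \<in> carrier G" "b \<in> carrier G" "b' \<in> carrier G"
      using A Q by (auto simp: C_def)
    have "b' \<otimes> inv b \<in> \<Delta>" using h by (auto simp: \<Delta>_def diff_set_image C_def)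
    then show "b' \<otimes> inv b \<in> \<Delta> \<and> b \<in> R (b' \<otimes> inv b) \<and> x \<otimes> b \<in> R (b' \<otimes> inv b)
        \<and> y \<otimes> b \<in> R (b' \<otimes> inv b)"
      using h diff c by (auto simp: C_def R_def)
  qed
  from card_inj_on_le[OF inj this] have "card ?L \<le> card ?R"
    using \<Delta> fin by auto
  moreover have "card ?L = (\<Sum>(x, y)\<in>Q. (card {b \<in> A. x \<otimes> b \<in> A \<and> y \<otimes> b \<in> A})\<^sup>2)"
    using Q fin by (auto simp: card_SigmaI card_cartesian_product C_def power2_eq_square
        intro!: sum.cong split: prod.splits)
  moreover have "card ?R = energy3 G A"
    using \<Delta> A fin diff_count_eq[OF A(2)]
    by (auto simp: card_SigmaI card_cartesian_product power3_eq_cube energy3_eq R_def \<Delta>_def subset_iff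
        intro!: sum.cong)
  ultimately show ?thesis by simp
qed

text \<open>
  The weight is \<open>(A \<circ> A)(a - c)\<close> and not the indicator of \<open>a - c \<in> S\<close>: the graph on \<open>A\<close> with edges
  \<open>a - b \<in> S\<close> may be bipartite, hence free of triangles, but \<open>A \<circ> A\<close> is positive definite, so that the
  weighted number of 2-paths is a sum of squares.
\<close>

lemma weighted_paths_lower_bound:
  fixes A S
  defines "nb \<equiv> \<lambda>b. {a \<in> A. a \<otimes> inv b \<in> S}"
  assumes A: "finite A" "A \<subseteq> carrier G" "A \<noteq> {}"
    and S: "S \<subseteq> A <#> set_inv A" "S = set_inv S"
  shows "(\<Sum>x\<in>S. real (diff_count G A x)) ^ 4
    \<le> card S * real (card A) ^ 3 * (\<Sum>b\<in>A. \<Sum>a\<in>nb b. \<Sum>c\<in>nb b. real (diff_count G A (a \<otimes> inv c)))"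
proof -
  let ?N = "real (card A)"
  let ?W = "\<Sum>b\<in>A. \<Sum>a\<in>nb b. \<Sum>c\<in>nb b. real (diff_count G A (a \<otimes> inv c))"
  define \<Delta> where "\<Delta> = A <#> set_inv A"
  have \<Delta>: "finite \<Delta>" "\<Delta> \<subseteq> carrier G"
    unfolding \<Delta>_def using A by (auto simp: set_inv_image set_mult_image)
  have Sf: "finite S" "S \<subseteq> carrier G"
    using S(1) \<Delta> finite_subset unfolding \<Delta>_def by blast+
  have nb: "finite (nb b)" "nb b \<subseteq> A" for b
    using A by (auto simp: nb_def)
  have nb_sym: "a \<in> nb b \<longleftrightarrow> b \<in> nb a" if "a \<in> A" "b \<in> A" for a b
  proof -
    have "a \<in> carrier G" "b \<in> carrier G" using that A by auto
    then have eq: "b \<otimes> inv a = inv (a \<otimes> inv b)" "a \<otimes> inv b = inv (b \<otimes> inv a)"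
      by (simp_all add: inv_mult_group)
    have inv_S: "inv x \<in> S" if "x \<in> S" for x
    proof -
      have "inv x \<in> set_inv S" using that by (auto simp: SET_INV_def)
      with S(2) show ?thesis by blast
    qed
    have "a \<otimes> inv b \<in> S \<longleftrightarrow> b \<otimes> inv a \<in> S"
      using inv_S[of "a \<otimes> inv b"] inv_S[of "b \<otimes> inv a"] unfolding eq[symmetric] by blast
    then show ?thesis using that by (simp add: nb_def)
  qed
  have edges: "(\<Sum>v\<in>A. real (card (nb v))) = (\<Sum>x\<in>S. real (diff_count G A x))"
    unfolding nb_def by (rule sum_card_difference_in[OF A(1) S(1)])
  \<comment> \<open>The pairs \<open>(w, b)\<close> index the squares in the sum:
    \<open>F (w, b)\<close> collects the neighbours of \<open>b\<close> that stay in
    \<open>A\<close> after a shift by \<open>w\<close>.\<close>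
  define F where "F = (\<lambda>(w, b). {v \<in> nb b. w \<otimes> v \<in> A})"
  have F_fin: "finite (F p)" for p using nb by (auto simp: F_def split: prod.splits)
  have F_sum: "(\<Sum>p\<in>S \<times> A. real (card (F p))) = (\<Sum>v\<in>A. (real (card (nb v)))\<^sup>2)"
  proof -
    have "(\<Sum>p\<in>S \<times> A. real (card (F p))) = (\<Sum>w\<in>S. \<Sum>b\<in>A. real (card (F (w, b))))"
      by (simp add: sum.cartesian_product)
    also have "\<dots> = (\<Sum>w\<in>S. \<Sum>b\<in>A. \<Sum>v\<in>A. (if v \<in> nb b then 1 else 0) * (if w \<otimes> v \<in> A then 1 else 0))"
    proof (intro sum.cong refl)
      fix w b
      have "(\<Sum>v\<in>A. (if v \<in> nb b then 1 else 0) * (if w \<otimes> v \<in> A then 1 else 0))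
         = (\<Sum>v\<in>A. if v \<in> F (w, b) then 1 else (0::real))"
        by (intro sum.cong) (auto simp: F_def)
      also have "\<dots> = card (F (w, b))"
      proof -
        have "A \<inter> {v. v \<in> F (w, b)} = F (w, b)" using nb(2) by (auto simp: F_def)
        then show ?thesis using A by (simp add: sum.If_cases)
      qed
      finally show "real (card (F (w, b))) =
          (\<Sum>v\<in>A. (if v \<in> nb b then 1 else 0) * (if w \<otimes> v \<in> A then 1 else 0))" by simp
    qed
    also have "\<dots> = (\<Sum>v\<in>A. \<Sum>w\<in>S. \<Sum>b\<in>A. (if v \<in> nb b then 1 else 0) * (if w \<otimes> v \<in> A then 1 else 0))"
      by (subst (2) sum.swap, subst sum.swap) (rule refl)
    also have "\<dots> = (\<Sum>v\<in>A. (\<Sum>w\<in>S. if w \<otimes> v \<in> A then 1 else 0) * (\<Sum>b\<in>A. if v \<in> nb b then 1 else (0::real)))"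
      by (intro sum.cong refl, subst sum.swap) (simp add: sum_product mult.commute)
    \<comment> \<open>Both factors are the degree of \<open>v\<close>: the shifts \<open>w\<close>
      in \<open>S\<close> with \<open>w + v\<close> in \<open>A\<close> correspond to the neighbours
      \<open>w + v\<close>, and the second factor counts neighbours by the symmetry of
      \<open>S\<close>.\<close>
    also have "\<dots> = (\<Sum>v\<in>A. (real (card (nb v)))\<^sup>2)"
    proof (intro sum.cong refl)
      fix v assume v: "v \<in> A"
      have "A \<inter> {b. v \<in> nb b} = nb v" using nb_sym v nb(2) by blast
      then have 1: "(\<Sum>b\<in>A. if v \<in> nb b then 1 else (0::real)) = card (nb v)"
        using A by (simp add: sum.If_cases)
      have vc: "v \<in> carrier G" using v A by auto
      have "nb v = (\<lambda>w. w \<otimes> v) ` (S \<inter> {w. w \<otimes> v \<in> A})"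
      proof (intro equalityI subsetI)
        fix a assume a: "a \<in> nb v"
        then have "a \<otimes> inv v \<otimes> v = a" using A vc by (auto simp: nb_def m_assoc)
        then show "a \<in> (\<lambda>w. w \<otimes> v) ` (S \<inter> {w. w \<otimes> v \<in> A})"
          using a by (intro image_eqI[of _ _ "a \<otimes> inv v"]) (auto simp: nb_def)
      next
        fix a assume "a \<in> (\<lambda>w. w \<otimes> v) ` (S \<inter> {w. w \<otimes> v \<in> A})"
        then obtain w where w: "w \<in> S" "w \<otimes> v \<in> A" "a = w \<otimes> v" by auto
        then have "a \<otimes> inv v = w" using Sf vc by (auto simp: m_assoc)
        then show "a \<in> nb v" using w by (auto simp: nb_def)
      qed
      moreover have "inj_on (\<lambda>w. w \<otimes> v) (S \<inter> {w. w \<otimes> v \<in> A})"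
        using Sf vc by (intro inj_onI) (metis IntD1 right_cancel subsetD)
      ultimately have "card (nb v) = card (S \<inter> {w. w \<otimes> v \<in> A})" by (simp add: card_image)
      then have 2: "(\<Sum>w\<in>S. if w \<otimes> v \<in> A then 1 else (0::real)) = card (nb v)"
        using Sf by (simp add: sum.If_cases)
      show "(\<Sum>w\<in>S. if w \<otimes> v \<in> A then 1 else 0) * (\<Sum>b\<in>A. if v \<in> nb b then 1 else (0::real))
          = (real (card (nb v)))\<^sup>2"
        unfolding 1 2 by (simp add: power2_eq_square)
    qed
    finally show ?thesis .
  qed
  \<comment> \<open>For a fixed pair \<open>(a, c)\<close> of neighbours of \<open>b\<close>, a
    shift \<open>w\<close> that keeps both in \<open>A\<close> is determined by
    \<open>u = w + c\<close>, an element of \<open>A\<close> that \<open>a - c\<close> moves to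
    \<open>w + a\<close> in \<open>A\<close>. At most \<open>(A \<circ> A)(a - c)\<close> shifts are
    therefore possible.\<close>
  have F_sq: "(\<Sum>p\<in>S \<times> A. (real (card (F p)))\<^sup>2) \<le> ?W"
  proof -
    have "(\<Sum>w\<in>S. (card (F (w, b)))\<^sup>2) \<le> (\<Sum>p\<in>nb b \<times> nb b. diff_count G A (fst p \<otimes> inv (snd p)))"
      if b: "b \<in> A" for b
    proof -
      define R where "R = (\<lambda>p. {u \<in> A. (fst p \<otimes> inv (snd p)) \<otimes> u \<in> A})"
      have Rf: "finite (R p)" for p using A by (simp add: R_def)
      let ?L = "SIGMA w:S. F (w, b) \<times> F (w, b)"
      let ?R = "SIGMA p:nb b \<times> nb b. R p"
      let ?f = "\<lambda>(w, a, c). ((a, c), w \<otimes> c)"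
      have F_car: "x \<in> carrier G" "x \<in> nb b" "w \<otimes> x \<in> A" if "x \<in> F (w, b)" for x w
        using that A nb by (auto simp: F_def)
      have inj: "inj_on ?f ?L"
        by (rule inj_onI, clarsimp) (metis F_car(1) Sf(2) right_cancel subsetD)
      have "?f ` ?L \<subseteq> ?R"
      proof clarsimp
        fix w a c assume h: "w \<in> S" "a \<in> F (w, b)" "c \<in> F (w, b)"
        have car: "w \<in> carrier G" "a \<in> carrier G" "c \<in> carrier G" using h F_car Sf by auto
        have "a \<otimes> inv c \<otimes> (w \<otimes> c) = (w \<otimes> a) \<otimes> (inv c \<otimes> c)"
          using car by (simp only: m_ac inv_closed m_closed)
        then have "a \<otimes> inv c \<otimes> (w \<otimes> c) = w \<otimes> a" using car by simp
        then show "a \<in> nb b \<and> c \<in> nb b \<and> w \<otimes> c \<in> R (a, c)"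
          using F_car h by (auto simp: R_def)
      qed
      from card_inj_on_le[OF inj this] have "card ?L \<le> card ?R"
        using nb Rf by auto
      moreover have "card ?L = (\<Sum>w\<in>S. (card (F (w, b)))\<^sup>2)"
        using Sf F_fin by (simp add: card_SigmaI card_cartesian_product power2_eq_square)
      moreover have "card ?R = (\<Sum>p\<in>nb b \<times> nb b. diff_count G A (fst p \<otimes> inv (snd p)))"
      proof -
        have "diff_count G A (fst p \<otimes> inv (snd p)) = card (R p)" if "p \<in> nb b \<times> nb b" for p
        proof -
          have "fst p \<in> carrier G" "snd p \<in> carrier G" using that nb(2)[of b] A by auto
          then show ?thesis unfolding R_def by (intro diff_count_eq[OF A(2)]) simp
        qed
        then show ?thesis using nb Rf by (simp add: card_SigmaI)
      qed
      ultimately show ?thesis by simp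
    qed
    then have "(\<Sum>b\<in>A. \<Sum>w\<in>S. (card (F (w, b)))\<^sup>2)
        \<le> (\<Sum>b\<in>A. \<Sum>p\<in>nb b \<times> nb b. diff_count G A (fst p \<otimes> inv (snd p)))"
      by (rule sum_mono)
    then have "real (\<Sum>b\<in>A. \<Sum>w\<in>S. (card (F (w, b)))\<^sup>2)
        \<le> real (\<Sum>b\<in>A. \<Sum>p\<in>nb b \<times> nb b. diff_count G A (fst p \<otimes> inv (snd p)))"
      by (rule of_nat_mono)
    moreover have "(\<Sum>p\<in>S \<times> A. (real (card (F p)))\<^sup>2) = real (\<Sum>b\<in>A. \<Sum>w\<in>S. (card (F (w, b)))\<^sup>2)"
      by (subst sum.swap) (simp add: sum.cartesian_product split_def)
    moreover have "?W = real (\<Sum>b\<in>A. \<Sum>p\<in>nb b \<times> nb b. diff_count G A (fst p \<otimes> inv (snd p)))"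
      by (simp add: sum.cartesian_product split_def)
    ultimately show ?thesis by simp
  qed
  have N0: "?N > 0" using A by (simp add: card_gt_0_iff)
  let ?E = "\<Sum>x\<in>S. real (diff_count G A x)"
  let ?D = "\<Sum>v\<in>A. (real (card (nb v)))\<^sup>2"
  \<comment> \<open>Cauchy-Schwarz is used twice: over the vertices, passing from edges to squared
    degrees, and over \<open>S \<times> A\<close>, passing from the sizes of \<open>F\<close> to
    their squares.\<close>
  have 1: "?E\<^sup>2 \<le> ?D * ?N"
    unfolding edges[symmetric] by (rule sum_squared_le_sum_of_squares)
  have "?D\<^sup>2 \<le> (\<Sum>p\<in>S \<times> A. (real (card (F p)))\<^sup>2) * card (S \<times> A)"
    unfolding F_sum[symmetric] by (rule sum_squared_le_sum_of_squares)
  also have "\<dots> \<le> ?W * (card S * ?N)"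
    using F_sq by (simp add: card_cartesian_product mult_right_mono)
  finally have 2: "?D\<^sup>2 \<le> ?W * (card S * ?N)" .
  have "?E ^ 4 = (?E\<^sup>2)\<^sup>2" by simp
  also have "\<dots> \<le> (?D * ?N)\<^sup>2" using 1 by (intro power_mono) auto
  also have "\<dots> = ?D\<^sup>2 * ?N\<^sup>2" by (simp add: power_mult_distrib)
  also have "\<dots> \<le> (?W * (card S * ?N)) * ?N\<^sup>2" using 2 by (intro mult_right_mono) auto
  also have "\<dots> = card S * ?N ^ 3 * ?W" by (simp add: power2_eq_square power3_eq_cube)
  finally show ?thesis .
qed

end

section \<open>Dependent random choice, paths of length four, and dense pairs with popular
  difference\<close>

section \<open>Graphs of popular differences\<close>

text \<open>\<open>E\<close> is read as a bipartite graph between two copies of \<open>V\<close>.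
  The neighbourhood of a well chosen right vertex contains few pairs with few common neighbours.
  After vertices in many such pairs are removed, any two remaining ones are joined, through many
  middle vertices \<open>z\<close>, by many paths of length four.\<close>

lemma dependent_random_choice:
  fixes V :: "'v set" and E :: "('v \<times> 'v) set" and d \<delta> :: real
  assumes V: "finite V" "card V \<le> d" and E: "E \<subseteq> V \<times> V" "\<delta> * d\<^sup>2 \<le> card E"
    and pos: "\<delta> > 0" "d > 0"
  obtains U where "U \<subseteq> V" "\<delta> * d / 4 \<le> card U"
    "\<And>x x'. x \<in> U \<Longrightarrow> x' \<in> U \<Longrightarrow> \<delta> ^ 5 * d ^ 3 / 2 ^ 10
      \<le> card {(z, y, y') \<in> V \<times> V \<times> V. (x, y) \<in> E \<and> (z, y) \<in> E \<and> (z, y') \<in> E \<and> (x', y') \<in> E}"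
proof -
  define n where "n = (\<lambda>y. {x \<in> V. (x, y) \<in> E})"
  define co where "co = (\<lambda>x z. {y \<in> V. (x, y) \<in> E \<and> (z, y) \<in> E})"
  \<comment> \<open>With this threshold the bad pairs, summed over all neighbourhoods, amount to at
    most one sixteenth of the lower bound \<open>n_sq\<close> for the squared degrees.\<close>
  define \<tau> where "\<tau> = \<delta>\<^sup>2 * d / 16"
  define Bad where "Bad = {(x, z) \<in> V \<times> V. card (co x z) < \<tau>}"
  define bad where "bad = (\<lambda>y. Bad \<inter> n y \<times> n y)"
  have \<tau>: "\<tau> > 0" using pos by (simp add: \<tau>_def)
  have fin: "finite E" "finite (n y)" "finite (co x z)" "finite Bad" "finite (bad y)" for x y z
    using V(1) finite_subset[OF E(1)] by (auto simp: n_def co_def Bad_def bad_def intro: finite_subset[of _ "V \<times> V"])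
  have "E = prod.swap ` (SIGMA y:V. n y)"
    using E(1) by (auto simp: n_def image_iff)
  then have "card E = card (SIGMA y:V. n y)"
    by (metis card_image inj_swap inj_on_subset subset_UNIV)
  then have "real (card E) = (\<Sum>y\<in>V. real (card (n y)))"
    using V fin by (simp add: card_SigmaI)
  then have "(real (card E))\<^sup>2 \<le> (\<Sum>y\<in>V. (real (card (n y)))\<^sup>2) * card V"
    using sum_squared_le_sum_of_squares[of "\<lambda>y. real (card (n y))" V] by simp
  also have "\<dots> \<le> (\<Sum>y\<in>V. (real (card (n y)))\<^sup>2) * d"
    using V by (intro mult_left_mono sum_nonneg) auto
  finally have "(real (card E))\<^sup>2 \<le> (\<Sum>y\<in>V. (real (card (n y)))\<^sup>2) * d" .
  moreover have "(\<delta> * d\<^sup>2)\<^sup>2 \<le> (real (card E))\<^sup>2"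
    using E(2) pos by (intro power_mono) auto
  ultimately have "(\<delta>\<^sup>2 * d ^ 3) * d \<le> (\<Sum>y\<in>V. (real (card (n y)))\<^sup>2) * d"
    by (simp add: power2_eq_square power3_eq_cube mult_ac)
  then have n_sq: "\<delta>\<^sup>2 * d ^ 3 \<le> (\<Sum>y\<in>V. (real (card (n y)))\<^sup>2)"
    using pos by simp
  \<comment> \<open>Double counting: a bad pair lies in the neighbourhood of \<open>y\<close>
    exactly when \<open>y\<close> is one of its common neighbours, of which there are fewer than
    \<open>\<tau>\<close>.\<close>
  have "bij_betw (\<lambda>(y, p). (p, y)) (SIGMA y:V. bad y) (SIGMA p:Bad. co (fst p) (snd p))"
    by (rule bij_betwI[where g = "\<lambda>(p, y). (y, p)"]) (auto simp: bad_def co_def n_def Bad_def)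
  then have "card (SIGMA y:V. bad y) = card (SIGMA p:Bad. co (fst p) (snd p))"
    by (rule bij_betw_same_card)
  then have "(\<Sum>y\<in>V. card (bad y)) = (\<Sum>p\<in>Bad. card (co (fst p) (snd p)))"
    using V fin by (simp add: card_SigmaI)
  then have "(\<Sum>y\<in>V. real (card (bad y))) = (\<Sum>p\<in>Bad. real (card (co (fst p) (snd p))))"
    by (metis of_nat_sum)
  also have "\<dots> \<le> (\<Sum>p\<in>Bad. \<tau>)"
    by (intro sum_mono) (auto simp: Bad_def)
  also have "\<dots> = card Bad * \<tau>" by simp
  also have "\<dots> \<le> d\<^sup>2 * \<tau>"
  proof -
    have "card Bad \<le> card (V \<times> V)" using V by (intro card_mono) (auto simp: Bad_def)
    then have "real (card Bad) \<le> real (card V) * card V"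
      by (metis card_cartesian_product of_nat_le_iff of_nat_mult)
    also have "\<dots> \<le> d * d" using V by (intro mult_mono) auto
    finally show ?thesis using \<tau> by (simp add: power2_eq_square)
  qed
  also have "\<dots> = \<delta>\<^sup>2 * d ^ 3 / 16" by (simp add: \<tau>_def power2_eq_square power3_eq_cube)
  finally have bad_sum: "(\<Sum>y\<in>V. real (card (bad y))) \<le> \<delta>\<^sup>2 * d ^ 3 / 16" .
  \<comment> \<open>Averaging takes the place of a random choice. The weight 8 spends half of the
    squared degrees on the bad pairs, so that some vertex has both a large neighbourhood
    \<open>N\<close> and at most \<open>|N|^2 / 8\<close> bad pairs inside it.\<close>
  have "\<exists>y\<in>V. (\<delta> * d)\<^sup>2 / 2 \<le> (real (card (n y)))\<^sup>2 - 8 * card (bad y)"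
  proof (rule ccontr)
    assume "\<not> ?thesis"
    then have less: "(real (card (n y)))\<^sup>2 - 8 * card (bad y) < (\<delta> * d)\<^sup>2 / 2" if "y \<in> V" for y
      using that by force
    have "V \<noteq> {}"
    proof
      assume "V = {}"
      then have "card E = 0" using E(1) by auto
      then show False using E(2) pos by (simp add: mult_le_0_iff)
    qed
    then have "(\<Sum>y\<in>V. (real (card (n y)))\<^sup>2 - 8 * card (bad y)) < (\<Sum>y\<in>V. (\<delta> * d)\<^sup>2 / 2)"
      using V less by (intro sum_strict_mono) auto
    also have "\<dots> = card V * ((\<delta> * d)\<^sup>2 / 2)" by simp
    also have "\<dots> \<le> d * ((\<delta> * d)\<^sup>2 / 2)" using V by (intro mult_right_mono) auto
    also have "\<dots> = \<delta>\<^sup>2 * d ^ 3 / 2" by (simp add: power2_eq_square power3_eq_cube)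
    finally show False
      using n_sq bad_sum by (simp add: sum_subtractf sum_distrib_left[symmetric])
  qed
  then obtain y0 where y0: "y0 \<in> V" "(\<delta> * d)\<^sup>2 / 2 \<le> (real (card (n y0)))\<^sup>2 - 8 * card (bad y0)"
    by blast
  define N where "N = n y0"
  have N: "finite N" "N \<subseteq> V" using fin by (auto simp: N_def n_def)
  have "(\<delta> * d / 2)\<^sup>2 \<le> (\<delta> * d)\<^sup>2 / 2" using pos by (simp add: power2_eq_square)
  also have "\<dots> \<le> (real (card N))\<^sup>2" using y0 by (simp add: N_def)
  finally have N_ge: "\<delta> * d / 2 \<le> card N" by (rule power2_le_imp_le) simp
  have N_bad: "8 * real (card (bad y0)) \<le> (real (card N))\<^sup>2"
    using y0(2) zero_le_power2[of "\<delta> * d"] unfolding N_def by linarith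
  define b where "b = (\<lambda>x. {z \<in> N. (x, z) \<in> Bad})"
  have b: "finite (b x)" "b x \<subseteq> N" for x using N by (auto simp: b_def)
  \<comment> \<open>By Markov's inequality at most half of \<open>N\<close> is lost: each discarded
    vertex starts more than \<open>|N| / 4\<close> of the at most \<open>|N|^2 / 8\<close> bad
    pairs.\<close>
  define U where "U = {x \<in> N. card (b x) \<le> real (card N) / 4}"
  have U: "U \<subseteq> N" by (auto simp: U_def)
  have "bad y0 = (SIGMA x:N. b x)"
    by (auto simp: bad_def b_def N_def)
  then have "(\<Sum>x\<in>N. real (card (b x))) = card (bad y0)"
    using N b by (simp add: card_SigmaI)
  moreover have "(\<Sum>x\<in>N - U. real (card N) / 4) \<le> (\<Sum>x\<in>N - U. real (card (b x)))"
    by (intro sum_mono) (auto simp: U_def)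
  moreover have "(\<Sum>x\<in>N - U. real (card (b x))) \<le> (\<Sum>x\<in>N. real (card (b x)))"
    using N by (intro sum_mono2) auto
  ultimately have "card (N - U) * (real (card N) / 4) \<le> card (bad y0)" by simp
  moreover have "real (card (N - U)) = real (card N) - card U"
    using U N card_mono[OF N(1) U] by (simp add: card_Diff_subset finite_subset of_nat_diff)
  ultimately have "(real (card N) - card U) * (real (card N) / 4) \<le> card (bad y0)"
    by (simp only:)
  then have "8 * ((real (card N) - card U) * (real (card N) / 4)) \<le> card N * real (card N)"
    using N_bad unfolding power2_eq_square by linarith
  then have "(real (card N) - 2 * card U) * card N \<le> 0"
    by (simp add: algebra_simps)
  moreover have N0: "real (card N) > 0" using N_ge pos by (smt (verit) divide_pos_pos mult_pos_pos)
  ultimately have "card N \<le> 2 * real (card U)" by (simp add: mult_le_0_iff)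
  then have U_ge: "\<delta> * d / 4 \<le> card U" using N_ge by linarith
  show thesis
  proof (rule that[of U])
    show "U \<subseteq> V" using U N by blast
    show "\<delta> * d / 4 \<le> card U" by (fact U_ge)
    fix x x' assume x: "x \<in> U" "x' \<in> U"
    \<comment> \<open>The middle vertices good for both endpoints. Each endpoint excludes at most a
      quarter of \<open>N\<close>, so half of \<open>N\<close> is left, and every \<open>z\<close>
      in \<open>Z\<close> gives at least \<open>\<tau> * \<tau>\<close> choices of \<open>y\<close>
      and \<open>y'\<close>.\<close>
    define Z where "Z = N - (b x \<union> b x')"
    have Z: "finite Z" using N by (simp add: Z_def)
    have "card (b x \<union> b x') \<le> real (card (b x)) + card (b x')"
      by (metis card_Un_le of_nat_add of_nat_mono)
    also have "\<dots> \<le> real (card N) / 2" using x by (simp add: U_def)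
    finally have "card Z \<ge> real (card N) / 2"
      unfolding Z_def using b N card_mono[of N "b x \<union> b x'"]
      by (subst card_Diff_subset) (auto simp: of_nat_diff)
    then have Z_ge: "card Z \<ge> \<delta> * d / 4" using N_ge by linarith
    have co_ge: "\<tau> \<le> card (co x z)" "\<tau> \<le> card (co x' z)" if "z \<in> Z" for z
      using that x U N(2) by (auto simp: Z_def b_def Bad_def)
    have "\<delta> ^ 5 * d ^ 3 / 2 ^ 10 = (\<delta> * d / 4) * \<tau>\<^sup>2"
    proof -
      have "\<tau>\<^sup>2 = \<delta> ^ 4 * d\<^sup>2 / 256"
        by (simp add: \<tau>_def power_divide power_mult_distrib power_mult[symmetric])
      moreover have "\<delta> ^ 5 = \<delta> * \<delta> ^ 4" "d ^ 3 = d * d\<^sup>2"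
        by (simp_all add: eval_nat_numeral)
      ultimately show ?thesis by simp
    qed
    also have "\<dots> \<le> card Z * \<tau>\<^sup>2" using Z_ge by (intro mult_right_mono) auto
    also have "\<dots> = (\<Sum>z\<in>Z. \<tau> * \<tau>)" by (simp add: power2_eq_square)
    also have "\<dots> \<le> (\<Sum>z\<in>Z. real (card (co x z)) * card (co x' z))"
      using co_ge \<tau> by (intro sum_mono mult_mono) auto
    also have "\<dots> = card (SIGMA z:Z. co x z \<times> co x' z)"
      using Z fin by (simp add: card_SigmaI card_cartesian_product)
    also have "\<dots> \<le> card {(z, y, y') \<in> V \<times> V \<times> V.
        (x, y) \<in> E \<and> (z, y) \<in> E \<and> (z, y') \<in> E \<and> (x', y') \<in> E}"
    proof (intro of_nat_mono card_mono)
      show "finite {(z, y, y') \<in> V \<times> V \<times> V.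
          (x, y) \<in> E \<and> (z, y) \<in> E \<and> (z, y') \<in> E \<and> (x', y') \<in> E}"
        by (rule finite_subset[of _ "V \<times> V \<times> V"]) (use V in auto)
    qed (use N(2) in \<open>auto simp: Z_def co_def\<close>)
    finally show "\<delta> ^ 5 * d ^ 3 / 2 ^ 10 \<le> card {(z, y, y') \<in> V \<times> V \<times> V.
        (x, y) \<in> E \<and> (z, y) \<in> E \<and> (z, y') \<in> E \<and> (x', y') \<in> E}" .
  qed
qed

context comm_group
begin

text \<open>A path telescopes: \<open>x - x' = (x - y) - (z - y) + (z - y') - (x' - y')\<close>. So
  a path yields a quadruple in \<open>P\<close> that determines the difference
  \<open>x - x'\<close>. Once the endpoints are fixed for each difference, the quadruple also
  determines \<open>y\<close>, \<open>y'\<close> and \<open>z\<close>, and quadruples from distinct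
  paths are distinct.\<close>

lemma card_diff_set_le_of_paths:
  fixes R :: real
  assumes V: "finite V" "V \<subseteq> carrier G" and P: "finite P" and U: "U \<subseteq> V"
    and paths: "\<And>x x'. x \<in> U \<Longrightarrow> x' \<in> U \<Longrightarrow> R \<le> card {(z, y, y') \<in> V \<times> V \<times> V.
      x \<otimes> inv y \<in> P \<and> z \<otimes> inv y \<in> P \<and> z \<otimes> inv y' \<in> P \<and> x' \<otimes> inv y' \<in> P}"
  shows "R * card (U <#> set_inv U) \<le> real (card P) ^ 4"
proof -
  define D where "D = U <#> set_inv U"
  have Uf: "finite U" "U \<subseteq> carrier G" using U V finite_subset by auto
  have D: "finite D" using Uf by (simp add: D_def set_inv_image)
  have "\<forall>w\<in>D. \<exists>p. fst p \<in> U \<and> snd p \<in> U \<and> w = fst p \<otimes> inv (snd p)"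
    by (auto simp: D_def set_mult_def SET_INV_def)
  then obtain p where p: "\<And>w. w \<in> D \<Longrightarrow>
      fst (p w) \<in> U \<and> snd (p w) \<in> U \<and> w = fst (p w) \<otimes> inv (snd (p w))"
    by metis
  define L where "L = (\<lambda>w. {(z, y, y') \<in> V \<times> V \<times> V. fst (p w) \<otimes> inv y \<in> P \<and>
      z \<otimes> inv y \<in> P \<and> z \<otimes> inv y' \<in> P \<and> snd (p w) \<otimes> inv y' \<in> P})"
  have L: "finite (L w)" for w
    by (rule finite_subset[of _ "V \<times> V \<times> V"]) (use V in \<open>auto simp: L_def\<close>)
  define f where "f = (\<lambda>(w, z, y, y').
      (fst (p w) \<otimes> inv y, z \<otimes> inv y, z \<otimes> inv y', snd (p w) \<otimes> inv y'))"
  have telescope: "(u \<otimes> inv y) \<otimes> inv (z \<otimes> inv y) \<otimes> (z \<otimes> inv y') \<otimes> inv (v \<otimes> inv y') = u \<otimes> inv v"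
    if "u \<in> carrier G" "v \<in> carrier G" "y \<in> carrier G" "y' \<in> carrier G" "z \<in> carrier G" for u v y y' z
  proof -
    have "(u \<otimes> inv y) \<otimes> inv (z \<otimes> inv y) \<otimes> (z \<otimes> inv y') \<otimes> inv (v \<otimes> inv y')
        = (u \<otimes> inv v) \<otimes> ((y \<otimes> inv y) \<otimes> ((z \<otimes> inv z) \<otimes> (y' \<otimes> inv y')))"
      using that by (simp only: inv_mult inv_inv m_ac inv_closed m_closed)
    then show ?thesis using that by simp
  qed
  have inj: "inj_on f (SIGMA w:D. L w)"
  proof (rule inj_onI, unfold split_paired_all)
    fix w z y y' w1 z1 y1 y1'
    assume h: "(w, z, y, y') \<in> (SIGMA w:D. L w)" "(w1, z1, y1, y1') \<in> (SIGMA w:D. L w)"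
      and eq: "f (w, z, y, y') = f (w1, z1, y1, y1')"
    have w: "w \<in> D" "w1 \<in> D" using h by auto
    have c: "y \<in> carrier G" "y' \<in> carrier G" "z \<in> carrier G"
      "y1 \<in> carrier G" "y1' \<in> carrier G" "z1 \<in> carrier G"
      "fst (p w) \<in> carrier G" "snd (p w) \<in> carrier G"
      "fst (p w1) \<in> carrier G" "snd (p w1) \<in> carrier G"
      using h V Uf p[OF w(1)] p[OF w(2)] by (auto simp: L_def)
    have eqs: "fst (p w) \<otimes> inv y = fst (p w1) \<otimes> inv y1" "z \<otimes> inv y = z1 \<otimes> inv y1"
      "z \<otimes> inv y' = z1 \<otimes> inv y1'" "snd (p w) \<otimes> inv y' = snd (p w1) \<otimes> inv y1'"
      using eq by (auto simp: f_def)
    have "w = w1"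
      using telescope[of "fst (p w)" "snd (p w)" y y' z] telescope[of "fst (p w1)" "snd (p w1)" y1 y1' z1]
        eqs c p[OF w(1)] p[OF w(2)] by metis
    moreover from this have "inv y = inv y1" "inv y' = inv y1'" using eqs c by auto
    then have "y = y1" "y' = y1'" using c by (metis inv_inv)+
    moreover from this have "z = z1" using eqs c by simp
    ultimately show "(w, z, y, y') = (w1, z1, y1, y1')" by simp
  qed
  have "f ` (SIGMA w:D. L w) \<subseteq> P \<times> P \<times> P \<times> P"
    by (auto simp: f_def L_def)
  from card_inj_on_le[OF inj this] have "card (SIGMA w:D. L w) \<le> card (P \<times> P \<times> P \<times> P)"
    using P by simp
  then have "real (card (SIGMA w:D. L w)) \<le> real (card (P \<times> P \<times> P \<times> P))"
    by (rule of_nat_mono)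
  also have "\<dots> = real (card P) ^ 4"
    by (simp add: card_cartesian_product eval_nat_numeral)
  finally have "real (card (SIGMA w:D. L w)) \<le> real (card P) ^ 4" .
  moreover have "(\<Sum>w\<in>D. R) \<le> (\<Sum>w\<in>D. real (card (L w)))"
    using paths p unfolding L_def by (intro sum_mono) blast
  moreover have "real (card (SIGMA w:D. L w)) = (\<Sum>w\<in>D. real (card (L w)))"
    using D L by (simp add: card_SigmaI)
  moreover have "(\<Sum>w\<in>D. R) = R * card D" by simp
  ultimately show ?thesis
    unfolding D_def[symmetric] by linarith
qed

text \<open>The conditions on \<open>t\<close> and \<open>T\<close> ensure that unpopular and
  excessively popular differences each carry at most a quarter of the weight \<open>W\<close>. At
  least \<open>W / (2 * T)\<close> triples with \<open>a - c\<close> in \<open>P\<close> remain.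
  They are grouped by the pair \<open>(a - b, c - b)\<close>, and Cauchy-Schwarz together with the
  corner bound converts triples into pairs.\<close>

lemma popular_pairs:
  fixes A S and t T W :: real
  defines "nb \<equiv> \<lambda>b. {a \<in> A. a \<otimes> inv b \<in> S}"
    and "P \<equiv> {z \<in> A <#> set_inv A. t \<le> diff_count G A z}"
  assumes A: "finite A" "A \<subseteq> carrier G" and S: "finite S" "S \<subseteq> carrier G"
    and W: "0 < W" "W \<le> (\<Sum>b\<in>A. \<Sum>a\<in>nb b. \<Sum>c\<in>nb b. real (diff_count G A (a \<otimes> inv c)))"
    and t: "0 < t" "t * real (card A) ^ 3 \<le> W / 4"
    and T: "0 < T" "card A * real (energy3 G A) \<le> T * W / 4"
  shows "(W / (2 * T))\<^sup>2 \<le> energy3 G A * real (card {(x, y) \<in> S \<times> S. x \<otimes> inv y \<in> P})"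
proof -
  define r where "r = (\<lambda>a c. real (diff_count G A (a \<otimes> inv c)))"
  let ?N = "real (card A)"
  have nb: "finite (nb b)" "nb b \<subseteq> A" for b using A by (auto simp: nb_def)
  define Tr where "Tr = (\<lambda>b. {p \<in> nb b \<times> nb b. t \<le> r (fst p) (snd p)})"
  have Tr: "finite (Tr b)" for b
    by (rule finite_subset[of _ "nb b \<times> nb b"]) (use nb in \<open>auto simp: Tr_def\<close>)
  \<comment> \<open>Unpopular differences are absorbed by the first term, excessively popular ones by the last one,
    which sums to the third energy.\<close>
  have r_le: "r a c \<le> t + T * (if t \<le> r a c then 1 else 0) + (r a c)\<^sup>2 / T" for a c
  proof -
    have "r a c \<le> (r a c)\<^sup>2 / T" if "r a c > T"
      using that T by (simp add: power2_eq_square field_simps)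
    moreover have "(r a c)\<^sup>2 / T \<ge> 0" using T by simp
    ultimately show ?thesis using t T by (smt (verit) mult_cancel_left1 mult_cancel_right1 mult_zero_right)
  qed
  have nb_sum: "(\<Sum>a\<in>nb b. \<Sum>c\<in>nb b. r a c)
      \<le> t * ?N\<^sup>2 + T * card (Tr b) + (\<Sum>(c, a)\<in>A \<times> A. (r a c)\<^sup>2) / T" for b
  proof -
    have "(\<Sum>a\<in>nb b. \<Sum>c\<in>nb b. r a c) = (\<Sum>p\<in>nb b \<times> nb b. r (fst p) (snd p))"
      by (simp add: sum.cartesian_product split_def)
    also have "\<dots> \<le> (\<Sum>p\<in>nb b \<times> nb b. t + T * (if t \<le> r (fst p) (snd p) then 1 else 0)
        + (r (fst p) (snd p))\<^sup>2 / T)"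
      by (intro sum_mono r_le)
    also have "\<dots> = t * (real (card (nb b)))\<^sup>2 + T * card (Tr b)
        + (\<Sum>p\<in>nb b \<times> nb b. (r (fst p) (snd p))\<^sup>2) / T"
    proof -
      have "(\<Sum>p\<in>nb b \<times> nb b. if t \<le> r (fst p) (snd p) then 1 else (0::real)) = card (Tr b)"
        using nb by (simp add: sum.If_cases Tr_def Int_def)
      then show ?thesis
        by (simp add: sum.distrib card_cartesian_product power2_eq_square
            sum_distrib_left[symmetric] sum_divide_distrib[symmetric])
    qed
    also have "\<dots> \<le> t * ?N\<^sup>2 + T * card (Tr b) + (\<Sum>(c, a)\<in>A \<times> A. (r a c)\<^sup>2) / T"
    proof -
      have "real (card (nb b)) \<le> ?N" using nb A by (simp add: card_mono)
      then have "t * (real (card (nb b)))\<^sup>2 \<le> t * ?N\<^sup>2"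
        using t by (intro mult_left_mono power_mono) auto
      moreover have "(\<Sum>p\<in>nb b \<times> nb b. (r (fst p) (snd p))\<^sup>2) \<le> (\<Sum>p\<in>A \<times> A. (r (fst p) (snd p))\<^sup>2)"
        using nb[of b] A by (intro sum_mono2) auto
      moreover have "(\<Sum>p\<in>A \<times> A. (r (fst p) (snd p))\<^sup>2) = (\<Sum>(c, a)\<in>A \<times> A. (r a c)\<^sup>2)"
        by (rule sum.reindex_bij_witness[where i = prod.swap and j = prod.swap]) auto
      ultimately show ?thesis using T by (simp add: divide_right_mono add_mono)
    qed
    finally show ?thesis .
  qed
  \<comment> \<open>Grouping by the difference supplies one more factor of
    \<open>diff_count\<close>, which turns squares into cubes.\<close>
  have r_sq: "(\<Sum>(c, a)\<in>A \<times> A. (r a c)\<^sup>2) = energy3 G A"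
    using sum_diff_count[OF A(1), of "\<lambda>x. (real (diff_count G A x))\<^sup>2"] A
    by (simp add: r_def energy3_eq power2_eq_square power3_eq_cube mult.assoc)
  have "W \<le> (\<Sum>b\<in>A. \<Sum>a\<in>nb b. \<Sum>c\<in>nb b. r a c)"
    using W(2) by (simp add: r_def)
  also have "\<dots> \<le> (\<Sum>b\<in>A. t * ?N\<^sup>2 + T * card (Tr b) + real (energy3 G A) / T)"
    by (intro sum_mono nb_sum[unfolded r_sq])
  also have "\<dots> = t * ?N ^ 3 + T * (\<Sum>b\<in>A. real (card (Tr b))) + ?N * energy3 G A / T"
    by (simp add: sum.distrib sum_distrib_left power2_eq_square power3_eq_cube)
  also have "?N * energy3 G A / T \<le> W / 4" using T by (simp add: field_simps)
  finally have "W / 2 \<le> T * (\<Sum>b\<in>A. real (card (Tr b)))" using t(2) by linarith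
  then have W_le: "W / (2 * T) \<le> (\<Sum>b\<in>A. real (card (Tr b)))"
    using T by (simp add: field_simps)
  define Q where "Q = {(x, y) \<in> S \<times> S. x \<otimes> inv y \<in> P}"
  define C where "C = (\<lambda>p. {b \<in> A. fst p \<otimes> b \<in> A \<and> snd p \<otimes> b \<in> A})"
  have Q: "finite Q" "Q \<subseteq> carrier G \<times> carrier G"
    by (rule finite_subset[of _ "S \<times> S"]) (use S in \<open>auto simp: Q_def\<close>)
  have C: "finite (C p)" for p using A by (simp add: C_def)
  \<comment> \<open>A triple is recorded as a pair of differences together with its base point
    \<open>b\<close>; the popular difference of the pair is \<open>a - c\<close>, as
    \<open>b\<close> cancels.\<close>
  let ?f = "\<lambda>(b, a, c). ((a \<otimes> inv b, c \<otimes> inv b), b)"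
  have Tr_car: "a \<in> carrier G" "c \<in> carrier G" "b \<in> carrier G" if "(a, c) \<in> Tr b" "b \<in> A" for a b c
    using that A nb by (auto simp: Tr_def)
  have inj: "inj_on ?f (SIGMA b:A. Tr b)"
    by (rule inj_onI) (use Tr_car in auto)
  have "?f ` (SIGMA b:A. Tr b) \<subseteq> (SIGMA p:Q. C p)"
  proof clarsimp
    fix b a c assume h: "b \<in> A" "(a, c) \<in> Tr b"
    then have car: "a \<in> carrier G" "c \<in> carrier G" "b \<in> carrier G" using Tr_car by auto
    have mem: "a \<in> A" "c \<in> A" "a \<otimes> inv b \<in> S" "c \<otimes> inv b \<in> S" "t \<le> r a c"
      using h by (auto simp: Tr_def nb_def)
    have "(a \<otimes> inv b) \<otimes> inv (c \<otimes> inv b) = (a \<otimes> inv c) \<otimes> (b \<otimes> inv b)"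
      using car by (simp only: inv_mult inv_inv m_ac inv_closed m_closed)
    then have "(a \<otimes> inv b) \<otimes> inv (c \<otimes> inv b) = a \<otimes> inv c" using car by simp
    moreover have "a \<otimes> inv c \<in> P" using mem by (auto simp: P_def diff_set_image r_def)
    ultimately show "(a \<otimes> inv b, c \<otimes> inv b) \<in> Q \<and> b \<in> C (a \<otimes> inv b, c \<otimes> inv b)"
      using mem car h by (auto simp: Q_def C_def m_assoc)
  qed
  from card_inj_on_le[OF inj this] have "card (SIGMA b:A. Tr b) \<le> card (SIGMA p:Q. C p)"
    using Q C by auto
  then have "(\<Sum>b\<in>A. card (Tr b)) \<le> (\<Sum>p\<in>Q. card (C p))"
    using A Tr Q C by (simp add: card_SigmaI)
  then have "real (\<Sum>b\<in>A. card (Tr b)) \<le> real (\<Sum>p\<in>Q. card (C p))"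
    by (rule of_nat_mono)
  then have "W / (2 * T) \<le> (\<Sum>p\<in>Q. real (card (C p)))" using W_le by simp
  then have "(W / (2 * T))\<^sup>2 \<le> (\<Sum>p\<in>Q. real (card (C p)))\<^sup>2"
    using W T by (intro power_mono) auto
  \<comment> \<open>Few pairs could carry many triples only if the fibres \<open>C p\<close> were
    large, and their second moment is at most the third energy.\<close>
  also have "\<dots> \<le> (\<Sum>p\<in>Q. (real (card (C p)))\<^sup>2) * card Q"
    by (rule sum_squared_le_sum_of_squares)
  also have "(\<Sum>p\<in>Q. (real (card (C p)))\<^sup>2) \<le> energy3 G A"
  proof -
    have "(\<Sum>p\<in>Q. (card (C p))\<^sup>2) \<le> energy3 G A"
      using sum_corners_le_energy3[OF A Q] by (simp add: C_def split_def)
    then have "real (\<Sum>p\<in>Q. (card (C p))\<^sup>2) \<le> real (energy3 G A)" by (rule of_nat_mono)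
    then show ?thesis by simp
  qed
  finally show ?thesis by (simp add: Q_def mult_right_mono)
qed

end

section \<open>The set of popular differences with small doubling, and its passage to a subset of
  \<open>A\<close>\<close>

section \<open>Structured subsets\<close>

text \<open>The left side is the tangent at \<open>s\<close> to the convex function
  \<open>r ^ 3\<close>. Summed with \<open>s\<close> equal to the mean, it gives the power mean
  inequality.\<close>

lemma cube_tangent: "3 * s\<^sup>2 * r - 2 * s ^ 3 \<le> r ^ 3" if "0 \<le> r" "0 \<le> s" for r s :: real
proof -
  have "r ^ 3 - (3 * s\<^sup>2 * r - 2 * s ^ 3) = (r - s)\<^sup>2 * (r + 2 * s)"
    by (simp add: algebra_simps power2_eq_square power3_eq_cube)
  moreover have "0 \<le> (r - s)\<^sup>2 * (r + 2 * s)" using that by simp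
  ultimately show ?thesis by linarith
qed

context comm_group
begin

text \<open>With \<open>s\<close> the mean of \<open>A \<circ> A\<close> on \<open>D\<close>, the
  cubes over \<open>D\<close> alone sum to at least \<open>s ^ 3 * d\<close>, which is the value of
  the third energy for \<open>M = 1\<close>. The bound is what allows powers of \<open>M\<close> to
  be raised later.\<close>

lemma energy_parameter_ge_1:
  fixes \<eta> M :: real
  assumes A: "finite A" "A \<subseteq> carrier G" "A \<noteq> {}" and D: "finite D" "D \<noteq> {}" "D \<subseteq> A <#> set_inv A"
    and \<eta>: "0 < \<eta>" and D_sum: "(\<Sum>x\<in>D. real (diff_count G A x)) = \<eta> * real (card A) ^ 2"
    and energy: "real (energy3 G A) = \<eta> ^ 3 * M * real (card A) ^ 6 / real (card D) ^ 2"
  shows "1 \<le> M"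
proof -
  define N where "N = real (card A)"
  define d where "d = real (card D)"
  have pos: "N > 0" "d > 0" using A D by (simp_all add: N_def d_def card_gt_0_iff)
  define s where "s = \<eta> * N\<^sup>2 / d"
  have s: "s > 0" using pos \<eta> by (simp add: s_def)
  have fin: "finite (A <#> set_inv A)" using A by (simp add: set_inv_image)
  have "\<eta> ^ 3 * N ^ 6 / d\<^sup>2 = s ^ 3 * d"
    using pos by (simp add: s_def field_simps eval_nat_numeral)
  also have "\<dots> = (\<Sum>x\<in>D. 3 * s\<^sup>2 * real (diff_count G A x) - 2 * s ^ 3)"
    using pos by (simp add: sum_subtractf sum_distrib_left[symmetric] D_sum N_def[symmetric] d_def[symmetric])
      (simp add: s_def field_simps eval_nat_numeral)
  also have "\<dots> \<le> (\<Sum>x\<in>D. real (diff_count G A x) ^ 3)"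
    using s by (intro sum_mono cube_tangent) auto
  also have "\<dots> \<le> (\<Sum>x\<in>A <#> set_inv A. real (diff_count G A x) ^ 3)"
    using D fin by (intro sum_mono2) auto
  also have "\<dots> = real (energy3 G A)" using A by (simp add: energy3_eq)
  also have "\<dots> = M * (\<eta> ^ 3 * N ^ 6 / d\<^sup>2)" using energy by (simp add: N_def d_def)
  finally have "1 * (\<eta> ^ 3 * N ^ 6 / d\<^sup>2) \<le> M * (\<eta> ^ 3 * N ^ 6 / d\<^sup>2)" by simp
  then show ?thesis using pos \<eta> by (subst (asm) mult_le_cancel_right) (auto dest: divide_le_0_iff[THEN iffD1])
qed

text \<open>The graph on the popular part of \<open>D\<close>, with edges given by popular
  differences, is dense by \<open>popular_pairs\<close>. Dependent random choice finds
  \<open>U\<close> inside it, and the path bound controls \<open>U - U\<close>.\<close>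

lemma difference_core:
  fixes \<eta> M :: real
  assumes A: "finite A" "A \<subseteq> carrier G" "A \<noteq> {}" and D: "D \<subseteq> A <#> set_inv A" "D = set_inv D"
    and \<eta>: "0 < \<eta>" and D_sum: "(\<Sum>x\<in>D. real (diff_count G A x)) = \<eta> * real (card A) ^ 2"
    and energy: "real (energy3 G A) = \<eta> ^ 3 * M * real (card A) ^ 6 / real (card D) ^ 2"
    and M: "0 < M" and D_card: "0 < card D"
  obtains U where "U \<subseteq> D" "\<eta> ^ 7 / (2 ^ 24 * M ^ 3) * card D \<le> card U"
    "\<And>x. x \<in> U \<Longrightarrow> \<eta> * real (card A) ^ 2 / (2 * card D) \<le> diff_count G A x"
    "card (U <#> set_inv U) \<le> 2 ^ 168 * M ^ 18 / \<eta> ^ 58 * card U"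
proof -
  define N where "N = real (card A)"
  define d where "d = real (card D)"
  have pos: "N > 0" "d > 0" using A D_card by (simp_all add: N_def d_def card_gt_0_iff)
  define \<Delta> where "\<Delta> = A <#> set_inv A"
  have \<Delta>: "finite \<Delta>" "\<Delta> \<subseteq> carrier G"
    unfolding \<Delta>_def using A by (auto simp: set_inv_image set_mult_image)
  have Df: "finite D" "D \<subseteq> carrier G" using D(1) \<Delta> finite_subset by (auto simp: \<Delta>_def)
  define r where "r = (\<lambda>x. real (diff_count G A x))"
  \<comment> \<open>Half the mean of \<open>A \<circ> A\<close> on \<open>D\<close>, so that the
    elements of \<open>D\<close> below \<open>s\<close> carry at most half of the total
    mass.\<close>
  define s where "s = \<eta> * N\<^sup>2 / (2 * d)"
  define S where "S = {x \<in> D. s \<le> r x}"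
  have S: "S \<subseteq> D" "finite S" "S \<subseteq> carrier G" "S \<subseteq> A <#> set_inv A"
    using Df D(1) by (auto simp: S_def)
  have inv_D: "inv x \<in> D" if "x \<in> D" for x
  proof -
    have "inv x \<in> set_inv D" using that by (auto simp: SET_INV_def)
    with D(2) show ?thesis by blast
  qed
  have inv_S: "inv x \<in> S" if "x \<in> S" for x
    using that inv_D diff_count_inv[OF A(2)] Df by (auto simp: S_def r_def)
  have S_sym: "S = set_inv S"
  proof
    show "set_inv S \<subseteq> S" using inv_S by (auto simp: SET_INV_def)
    show "S \<subseteq> set_inv S"
    proof
      fix x assume x: "x \<in> S"
      then have "x = inv (inv x)" using S(3) by auto
      then show "x \<in> set_inv S" using inv_S[OF x] unfolding SET_INV_def by blast
    qed
  qed
  have S_sum: "\<eta> * N\<^sup>2 / 2 \<le> (\<Sum>x\<in>S. r x)"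
  proof -
    have "(\<Sum>x\<in>D - S. r x) \<le> (\<Sum>x\<in>D - S. s)"
      by (intro sum_mono) (auto simp: S_def)
    also have "\<dots> \<le> (\<Sum>x\<in>D. s)"
      using Df pos \<eta> by (intro sum_mono2) (auto simp: s_def)
    also have "\<dots> = \<eta> * N\<^sup>2 / 2" using pos by (simp add: s_def d_def[symmetric])
    finally have "(\<Sum>x\<in>D - S. r x) \<le> \<eta> * N\<^sup>2 / 2" .
    moreover have "(\<Sum>x\<in>D. r x) = (\<Sum>x\<in>D - S. r x) + (\<Sum>x\<in>S. r x)"
      using Df S by (intro sum.subset_diff) auto
    moreover have "(\<Sum>x\<in>D. r x) = \<eta> * N\<^sup>2" using D_sum by (simp add: r_def N_def)
    ultimately show ?thesis by linarith
  qed
  have S_card: "card S \<le> d" using Df S card_mono by (auto simp: d_def)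
  define nb where "nb = (\<lambda>b. {a \<in> A. a \<otimes> inv b \<in> S})"
  \<comment> \<open>\<open>W\<close> is \<open>(\<eta> * N^2 / 2)^4 / (d * N^3)\<close>, the bound
    for weighted paths. \<open>t\<close> and \<open>T\<close> make the two error terms of
    \<open>popular_pairs\<close> equal to \<open>W / 4\<close>, and \<open>\<delta>\<close> is the
    density that its conclusion then gives in \<open>S \<times> S\<close>.\<close>
  define W where "W = \<eta> ^ 4 * N ^ 5 / (16 * d)"
  define t where "t = \<eta> ^ 4 * N\<^sup>2 / (64 * d)"
  define T where "T = 64 * M * N\<^sup>2 / (\<eta> * d)"
  define P where "P = {z \<in> \<Delta>. t \<le> diff_count G A z}"
  define Q where "Q = {(x, y) \<in> S \<times> S. x \<otimes> inv y \<in> P}"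
  define \<delta> where "\<delta> = \<eta> ^ 7 / (2 ^ 22 * M ^ 3)"
  have pos2: "W > 0" "t > 0" "T > 0" "\<delta> > 0" "s > 0"
    using pos \<eta> M by (simp_all add: W_def t_def T_def \<delta>_def s_def)
  have W_le: "W \<le> (\<Sum>b\<in>A. \<Sum>a\<in>nb b. \<Sum>c\<in>nb b. real (diff_count G A (a \<otimes> inv c)))"
    (is "_ \<le> ?W")
  proof -
    have W0: "0 \<le> ?W" by (intro sum_nonneg) simp
    have "d * N ^ 3 * W = (\<eta> * N\<^sup>2 / 2) ^ 4"
      using pos by (simp add: W_def field_simps eval_nat_numeral)
    also have "\<dots> \<le> (\<Sum>x\<in>S. r x) ^ 4"
      using S_sum pos \<eta> by (intro power_mono) auto
    also have "\<dots> \<le> card S * N ^ 3 * ?W"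
      using weighted_paths_lower_bound[OF A S(4) S_sym] by (simp add: nb_def r_def N_def)
    also have "\<dots> \<le> d * N ^ 3 * ?W"
      using S_card W0 pos by (intro mult_right_mono) auto
    finally show ?thesis using pos by simp
  qed
  have Q_ge: "\<delta> * d\<^sup>2 \<le> card Q"
  proof -
    have "t * real (card A) ^ 3 \<le> W / 4"
      unfolding N_def[symmetric] by (simp add: t_def W_def field_simps eval_nat_numeral)
    moreover have "card A * real (energy3 G A) \<le> T * W / 4"
      unfolding energy N_def[symmetric] d_def[symmetric]
      using pos \<eta> by (simp add: T_def W_def field_simps eval_nat_numeral)
    ultimately have "(W / (2 * T))\<^sup>2 \<le> energy3 G A * real (card Q)"
      using popular_pairs[OF A(1,2) S(2,3) pos2(1) W_le[unfolded nb_def] pos2(2) _ pos2(3)]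
      by (simp add: Q_def P_def \<Delta>_def)
    also have "\<dots> = (\<eta> ^ 3 * M * N ^ 6 / d\<^sup>2) * card Q"
      unfolding energy by (simp add: N_def d_def)
    finally have "(W / (2 * T))\<^sup>2 \<le> (\<eta> ^ 3 * M * N ^ 6 / d\<^sup>2) * card Q" .
    moreover have "(W / (2 * T))\<^sup>2 = (\<eta> ^ 3 * M * N ^ 6 / d\<^sup>2) * (\<delta> * d\<^sup>2)"
      using pos \<eta> M by (simp add: W_def T_def \<delta>_def field_simps eval_nat_numeral)
    moreover have "\<eta> ^ 3 * M * N ^ 6 / d\<^sup>2 > 0" using pos \<eta> M by simp
    ultimately show ?thesis using mult_le_cancel_left_pos by metis
  qed
  have "Q \<subseteq> S \<times> S" by (auto simp: Q_def)
  from dependent_random_choice[OF S(2) S_card this Q_ge pos2(4) pos(2)]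
  obtain U where U: "U \<subseteq> S" "\<delta> * d / 4 \<le> card U"
    and paths: "\<And>x x'. x \<in> U \<Longrightarrow> x' \<in> U \<Longrightarrow> \<delta> ^ 5 * d ^ 3 / 2 ^ 10
      \<le> card {(z, y, y') \<in> S \<times> S \<times> S. (x, y) \<in> Q \<and> (z, y) \<in> Q \<and> (z, y') \<in> Q \<and> (x', y') \<in> Q}"
    by blast
  have P: "finite P" using \<Delta> by (simp add: P_def)
  \<comment> \<open>The total mass of \<open>A \<circ> A\<close> is \<open>N^2\<close>, and each
    element of \<open>P\<close> takes at least \<open>t\<close> of it.\<close>
  have P_card: "card P \<le> 64 * d / \<eta> ^ 4"
  proof -
    have "t * card P = (\<Sum>z\<in>P. t)" by simp
    also have "\<dots> \<le> (\<Sum>z\<in>P. r z)" by (intro sum_mono) (auto simp: P_def r_def)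
    also have "\<dots> \<le> (\<Sum>z\<in>\<Delta>. r z)" using \<Delta> by (intro sum_mono2) (auto simp: P_def r_def)
    also have "\<dots> = N\<^sup>2"
      using sum_diff_count[OF A(1), of "\<lambda>_. 1"]
      by (simp add: r_def \<Delta>_def N_def split_def card_cartesian_product power2_eq_square)
    also have "\<dots> = t * (64 * d / \<eta> ^ 4)" using pos \<eta> by (simp add: t_def)
    finally show ?thesis using mult_le_cancel_left_pos[OF pos2(2)] by blast
  qed
  have "\<delta> ^ 5 * d ^ 3 / 2 ^ 10 * card (U <#> set_inv U) \<le> real (card P) ^ 4"
  proof (rule card_diff_set_le_of_paths[OF S(2,3) P U(1)])
    fix x x' assume x: "x \<in> U" "x' \<in> U"
    let ?L = "{(z, y, y') \<in> S \<times> S \<times> S.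
        x \<otimes> inv y \<in> P \<and> z \<otimes> inv y \<in> P \<and> z \<otimes> inv y' \<in> P \<and> x' \<otimes> inv y' \<in> P}"
    have "finite ?L"
      by (rule finite_subset[of _ "S \<times> S \<times> S"]) (use S(2) in auto)
    moreover have "{(z, y, y') \<in> S \<times> S \<times> S. (x, y) \<in> Q \<and> (z, y) \<in> Q \<and> (z, y') \<in> Q \<and> (x', y') \<in> Q} \<subseteq> ?L"
      by (auto simp: Q_def)
    ultimately have "card {(z, y, y') \<in> S \<times> S \<times> S. (x, y) \<in> Q \<and> (z, y) \<in> Q \<and> (z, y') \<in> Q \<and> (x', y') \<in> Q}
      \<le> card ?L"
      by (rule card_mono)
    then show "\<delta> ^ 5 * d ^ 3 / 2 ^ 10 \<le> card {(z, y, y') \<in> S \<times> S \<times> S.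
        x \<otimes> inv y \<in> P \<and> z \<otimes> inv y \<in> P \<and> z \<otimes> inv y' \<in> P \<and> x' \<otimes> inv y' \<in> P}"
      using paths[OF x] by linarith
  qed
  also have "\<dots> \<le> (64 * d / \<eta> ^ 4) ^ 4" using P_card by (intro power_mono) auto
  also have "\<dots> = \<delta> ^ 5 * d ^ 3 / 2 ^ 10 * (2 ^ 34 * d / (\<eta> ^ 16 * \<delta> ^ 5))"
    using pos pos2 \<eta> by (simp add: field_simps eval_nat_numeral)
  finally have "card (U <#> set_inv U) \<le> 2 ^ 34 * d / (\<eta> ^ 16 * \<delta> ^ 5)"
    using pos pos2 by (subst (asm) mult_le_cancel_left_pos) auto
  \<comment> \<open>One more factor of \<open>\<delta> / 4\<close> is split off, in order to replace
    \<open>d\<close> by the size of \<open>U\<close>.\<close>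
  also have "\<dots> = 2 ^ 36 / (\<eta> ^ 16 * \<delta> ^ 6) * (\<delta> * d / 4)"
    using pos2(4) by (simp add: field_simps eval_nat_numeral)
  also have "\<dots> \<le> 2 ^ 36 / (\<eta> ^ 16 * \<delta> ^ 6) * card U"
    using U \<eta> pos2 by (intro mult_left_mono) auto
  also have "2 ^ 36 / (\<eta> ^ 16 * \<delta> ^ 6) = 2 ^ 168 * M ^ 18 / \<eta> ^ 58"
  proof -
    have "\<delta> ^ 6 = \<eta> ^ 42 / (2 ^ 132 * M ^ 18)"
      by (simp add: \<delta>_def power_divide power_mult_distrib power_mult[symmetric])
    moreover have "\<eta> ^ 16 * \<eta> ^ 42 = \<eta> ^ 58"
      by (simp add: power_add[symmetric])
    ultimately have "\<eta> ^ 16 * \<delta> ^ 6 = \<eta> ^ 58 / (2 ^ 132 * M ^ 18)"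
      by (simp only: times_divide_eq_right)
    moreover have "(2::real) ^ 36 * 2 ^ 132 = 2 ^ 168"
      by (simp add: power_add[symmetric] del: power_numeral)
    ultimately show ?thesis
      by (simp only: divide_divide_eq_right mult.assoc[symmetric])
  qed
  finally have U_diff: "card (U <#> set_inv U) \<le> 2 ^ 168 * M ^ 18 / \<eta> ^ 58 * card U" .
  show thesis
  proof (rule that[of U])
    show "U \<subseteq> D" using U S by blast
    show "\<eta> ^ 7 / (2 ^ 24 * M ^ 3) * card D \<le> card U"
      using U(2) by (simp add: \<delta>_def d_def field_simps)
    show "\<eta> * real (card A) ^ 2 / (2 * card D) \<le> diff_count G A x" if "x \<in> U" for x
      using that U(1) by (auto simp: S_def s_def r_def N_def d_def)
    show "card (U <#> set_inv U) \<le> 2 ^ 168 * M ^ 18 / \<eta> ^ 58 * card U" by (fact U_diff)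
  qed
qed

text \<open>Averaging over \<open>a\<close>: the sizes of the intersections of \<open>A\<close> with
  the translates \<open>U + a\<close> sum to the mass of \<open>A \<circ> A\<close> on
  \<open>U\<close>, which is at least \<open>\<rho> * |U|\<close>.\<close>

lemma rich_translate:
  fixes \<rho> :: real
  assumes A: "finite A" "A \<noteq> {}" and U: "U \<subseteq> A <#> set_inv A"
    and rich: "\<And>x. x \<in> U \<Longrightarrow> \<rho> \<le> diff_count G A x"
  obtains a where "a \<in> A" "\<rho> * card U \<le> card A * real (card {a' \<in> A. a' \<otimes> inv a \<in> U})"
proof -
  define k where "k = (\<lambda>a. real (card {a' \<in> A. a' \<otimes> inv a \<in> U}))"
  have "\<exists>a\<in>A. \<rho> * card U \<le> card A * k a"
  proof (rule ccontr)
    assume "\<not> ?thesis"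
    then have "card A * k a < \<rho> * card U" if "a \<in> A" for a
      using that by (meson not_le)
    then have "(\<Sum>a\<in>A. card A * k a) < (\<Sum>a\<in>A. \<rho> * card U)"
      by (rule sum_strict_mono[OF A])
    also have "(\<Sum>a\<in>A. card A * k a) = card A * (\<Sum>a\<in>A. k a)"
      by (rule sum_distrib_left[symmetric])
    also have "(\<Sum>a\<in>A. \<rho> * card U) = card A * (\<rho> * card U)"
      by (rule sum_constant)
    finally have "(\<Sum>a\<in>A. k a) < \<rho> * card U"
      using mult_less_cancel_left_pos[of "real (card A)"] A by (simp add: card_gt_0_iff)
    moreover have "(\<Sum>x\<in>U. \<rho>) \<le> (\<Sum>x\<in>U. real (diff_count G A x))"
      using rich by (intro sum_mono) auto
    ultimately show False
      using sum_card_difference_in[OF A(1) U] by (simp add: k_def mult.commute)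
  qed
  then show thesis using that by (auto simp: k_def)
qed

text \<open>\<open>B\<close> is the intersection of \<open>A\<close> with a rich translate of
  \<open>U\<close>. Then \<open>B - U\<close> lies in a translate of \<open>U - U\<close>, so adding
  \<open>B\<close> to \<open>-U\<close> expands it by a bounded factor, and Pluennecke-Ruzsa applies
  with base \<open>-U\<close>.\<close>

lemma structured_subset:
  fixes \<eta> M :: real
  assumes A: "finite A" "A \<subseteq> carrier G" "A \<noteq> {}" and D: "D \<subseteq> A <#> set_inv A" "D = set_inv D"
    and \<eta>: "0 < \<eta>" "\<eta> \<le> 1" and D_sum: "(\<Sum>x\<in>D. real (diff_count G A x)) = \<eta> * real (card A) ^ 2"
    and energy: "real (energy3 G A) = \<eta> ^ 3 * M * real (card A) ^ 6 / real (card D) ^ 2"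
  obtains B where "B \<subseteq> A" "1 / 2 ^ 25 * (\<eta> ^ 16 * real (card A) / M ^ 5) \<le> card B"
    "\<And>n m. card (sum_diff_set G n m B) \<le>
      2 * 2 ^ (168 * (n + m)) * (\<eta> ^ 15 / M ^ 5) powi (- (7 * (int n + int m)))
        * (real (card D) / (\<eta> * real (card A))) * real (card B)"
proof -
  define N where "N = real (card A)"
  define d where "d = real (card D)"
  have N0: "N > 0" using A by (simp add: N_def card_gt_0_iff)
  \<comment> \<open>The mass on \<open>D\<close> is positive; this keeps the divisions by
    \<open>card D\<close> away from the default value at zero.\<close>
  have "D \<noteq> {}" using D_sum N0 \<eta> by (auto simp: N_def)
  moreover have Df: "finite D" "D \<subseteq> carrier G"
    using finite_subset[OF D(1)] A(1) subset_trans[OF D(1) set_mult_closed[OF A(2) set_inv_closed[OF A(2)]]]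
    by (simp_all add: set_inv_image)
  ultimately have D0: "card D > 0" by (simp add: card_gt_0_iff)
  then have d0: "d > 0" by (simp add: d_def)
  have M: "1 \<le> M"
    using energy_parameter_ge_1[OF A Df(1) \<open>D \<noteq> {}\<close> D(1) \<eta>(1) D_sum energy] .
  then have M0: "0 < M" by simp
  obtain U where U: "U \<subseteq> D" "\<eta> ^ 7 / (2 ^ 24 * M ^ 3) * card D \<le> card U"
    and popular: "\<And>x. x \<in> U \<Longrightarrow> \<eta> * real (card A) ^ 2 / (2 * card D) \<le> diff_count G A x"
    and doubling: "card (U <#> set_inv U) \<le> 2 ^ 168 * M ^ 18 / \<eta> ^ 58 * card U"
    using difference_core[OF A D \<eta>(1) D_sum energy M0 D0] by blast
  have Uf: "finite U" "U \<subseteq> carrier G" "U \<subseteq> A <#> set_inv A"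
    using U Df D(1) finite_subset by auto
  have U0: "U \<noteq> {}"
  proof
    assume "U = {}"
    then have "\<eta> ^ 7 / (2 ^ 24 * M ^ 3) * card D \<le> 0" using U(2) by simp
    moreover have "0 < \<eta> ^ 7 / (2 ^ 24 * M ^ 3) * card D" using \<eta> M0 D0 by simp
    ultimately show False by linarith
  qed
  obtain a where a: "a \<in> A" and rich: "\<eta> * real (card A) ^ 2 / (2 * card D) * card U
      \<le> card A * real (card {a' \<in> A. a' \<otimes> inv a \<in> U})"
    using rich_translate[OF A(1,3) Uf(3) popular] by blast
  define B where "B = {a' \<in> A. a' \<otimes> inv a \<in> U}"
  have B: "B \<subseteq> A" "finite B" "B \<subseteq> carrier G" using A by (auto simp: B_def)
  have ac: "a \<in> carrier G" using a A by auto
  have "N * (\<eta> * N / (2 * d) * card U) \<le> N * card B"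
    using rich by (simp add: B_def N_def d_def power2_eq_square mult_ac)
  then have B_ge: "\<eta> * N / (2 * d) * card U \<le> card B"
    using mult_le_cancel_left_pos[OF N0] by blast
  then have U_le: "card U \<le> 2 * d / (\<eta> * N) * card B"
    using N0 d0 \<eta> by (simp add: field_simps)
  have B_large: "1 / 2 ^ 25 * (\<eta> ^ 16 * N / M ^ 5) \<le> card B"
  proof -
    \<comment> \<open>The sizes of \<open>U\<close> and of the rich translate give
      \<open>\<eta> ^ 8 / M ^ 3\<close>; the weaker target follows from
      \<open>\<eta> \<le> 1 \<le> M\<close>. The constant is \<open>2 ^ 24\<close> from
      \<open>U\<close> times 2 from the popularity threshold.\<close>
    have "\<eta> ^ 16 / M ^ 5 \<le> \<eta> ^ 8 / M ^ 3"
      using \<eta> M by (intro frac_le power_decreasing power_increasing) auto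
    then have "N / 2 ^ 25 * (\<eta> ^ 16 / M ^ 5) \<le> N / 2 ^ 25 * (\<eta> ^ 8 / M ^ 3)"
      using N0 by (intro mult_left_mono) auto
    also have "\<dots> = \<eta> * N / (2 * d) * (\<eta> ^ 7 / (2 ^ 24 * M ^ 3) * d)"
      using d0 M0 by (simp add: field_simps eval_nat_numeral)
    also have "\<dots> \<le> \<eta> * N / (2 * d) * card U"
      using U(2) N0 d0 \<eta> unfolding d_def[symmetric] by (intro mult_left_mono) auto
    finally show ?thesis using B_ge by (simp add: mult.commute)
  qed
  \<comment> \<open>The doubling constant is weakened to a seventh power of
    \<open>M ^ 5 / \<eta> ^ 15\<close>, so that \<open>K ^ (n + m)\<close> has the exponent of the
    target.\<close>
  define K where "K = 2 ^ 168 * (M ^ 5 / \<eta> ^ 15) ^ 7"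
  have K0: "0 \<le> K" using M0 \<eta> by (simp add: K_def)
  have K_ge: "2 ^ 168 * M ^ 18 / \<eta> ^ 58 \<le> K"
  proof -
    have "M ^ 18 / \<eta> ^ 58 \<le> M ^ 35 / \<eta> ^ 105"
      using \<eta> M by (intro frac_le power_decreasing power_increasing) auto
    also have "\<dots> = (M ^ 5 / \<eta> ^ 15) ^ 7"
      by (simp add: power_divide power_mult[symmetric])
    finally show ?thesis by (simp add: K_def)
  qed
  have "B <#> set_inv U \<subseteq> (U <#> set_inv U) #> a"
  proof
    fix w assume "w \<in> B <#> set_inv U"
    then obtain b u where b: "b \<in> B" and u: "u \<in> U" and w: "w = b \<otimes> inv u"
      by (auto simp: set_mult_def SET_INV_def)
    have car: "b \<in> carrier G" "u \<in> carrier G" using b u B Uf by auto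
    have "(b \<otimes> inv a) \<otimes> inv u \<otimes> a = (b \<otimes> inv u) \<otimes> (a \<otimes> inv a)"
      using car ac by (simp only: m_ac inv_closed m_closed)
    then have "w = (b \<otimes> inv a) \<otimes> inv u \<otimes> a" using car ac w by simp
    moreover have "b \<otimes> inv a \<in> U" using b by (simp add: B_def)
    ultimately show "w \<in> (U <#> set_inv U) #> a"
      using u unfolding r_coset_def set_mult_def SET_INV_def by blast
  qed
  then have "card (B <#> set_inv U) \<le> card ((U <#> set_inv U) #> a)"
    using Uf by (intro card_mono finite_translate) (auto simp: set_inv_image)
  also have "\<dots> = card (U <#> set_inv U)"
    using Uf ac by (intro card_translate set_mult_closed set_inv_closed)
  finally have "card (set_inv U <#> B) \<le> card (U <#> set_inv U)"
    using set_mult_comm[OF set_inv_closed[OF Uf(2)] B(3)] by simp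
  then have "card (set_inv U <#> B) \<le> 2 ^ 168 * M ^ 18 / \<eta> ^ 58 * card U"
    using doubling by linarith
  also have "\<dots> \<le> K * card U" using K_ge by (intro mult_right_mono) auto
  finally have "card (set_inv U <#> B) \<le> K * card (set_inv U)"
    using Uf by (simp add: card_set_inv)
  then have pr: "card (sum_diff_set G n m B) \<le> K ^ (n + m) * card U" for n m
    using pluennecke_ruzsa[of "set_inv U" B K n m] Uf U0 B
    by (simp add: card_set_inv set_inv_closed) (simp add: set_inv_image)
  show thesis
  proof (rule that[of B])
    show "B \<subseteq> A" by (fact B(1))
    show "1 / 2 ^ 25 * (\<eta> ^ 16 * real (card A) / M ^ 5) \<le> card B"
      using B_large by (simp add: N_def)
    fix n m
    have "(\<eta> ^ 15 / M ^ 5) powi (- (7 * (int n + int m))) = inverse ((\<eta> ^ 15 / M ^ 5) ^ (7 * (n + m)))"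
      by (metis of_nat_add of_nat_mult of_nat_numeral power_int_minus power_int_of_nat)
    also have "\<dots> = ((M ^ 5 / \<eta> ^ 15) ^ 7) ^ (n + m)"
      by (simp add: power_inverse[symmetric] power_mult[symmetric] distrib_left)
    finally have powi: "(\<eta> ^ 15 / M ^ 5) powi (- (7 * (int n + int m))) = ((M ^ 5 / \<eta> ^ 15) ^ 7) ^ (n + m)" .
    \<comment> \<open>Pluennecke-Ruzsa bounds the set by \<open>|U|\<close>; \<open>U_le\<close>
      exchanges this for \<open>|B|\<close> and produces the factor \<open>d / (\<eta> * N)\<close>
      as well as the constant 2.\<close>
    have "card (sum_diff_set G n m B) \<le> K ^ (n + m) * card U" by (fact pr)
    also have "\<dots> \<le> K ^ (n + m) * (2 * d / (\<eta> * N) * card B)"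
      using U_le K0 by (intro mult_left_mono) auto
    also have "K ^ (n + m) = 2 ^ (168 * (n + m)) * ((M ^ 5 / \<eta> ^ 15) ^ 7) ^ (n + m)"
      by (simp only: K_def power_mult_distrib power_mult)
    finally show "card (sum_diff_set G n m B) \<le>
      2 * 2 ^ (168 * (n + m)) * (\<eta> ^ 15 / M ^ 5) powi (- (7 * (int n + int m)))
        * (real (card D) / (\<eta> * real (card A))) * real (card B)"
      unfolding powi N_def d_def by (simp add: mult_ac)
  qed
qed

end

section \<open>Transport of the statement between groups and to the type \<open>nat\<close>\<close>

section \<open>Transfer along injective homomorphisms\<close>

context group_hom
begin

lemma diff_set_image_hom:
  assumes "A \<subseteq> carrier G"
  shows "h ` A <#>\<^bsub>H\<^esub> set_inv\<^bsub>H\<^esub> (h ` A) = h ` (A <#> set_inv A)"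
proof -
  have "h a \<otimes>\<^bsub>H\<^esub> inv\<^bsub>H\<^esub> h b = h (a \<otimes> inv b)" if "a \<in> A" "b \<in> A" for a b
    using that assms by (simp add: subsetD)
  then show ?thesis
    unfolding set_mult_def SET_INV_def image_UN by auto
qed

lemma set_inv_image_hom: "A \<subseteq> carrier G \<Longrightarrow> set_inv\<^bsub>H\<^esub> (h ` A) = h ` (set_inv A)"
  unfolding SET_INV_def image_UN by (auto simp: subsetD)

lemma diff_count_image:
  assumes inj: "inj_on h (carrier G)" and A: "A \<subseteq> carrier G" and x: "x \<in> carrier G"
  shows "diff_count H (h ` A) (h x) = diff_count G A x"
proof -
  have eq: "h a' \<otimes>\<^bsub>H\<^esub> inv\<^bsub>H\<^esub> h a = h x \<longleftrightarrow> a' \<otimes> inv a = x" if "a \<in> A" "a' \<in> A" for a a'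
  proof -
    have "a \<in> carrier G" "a' \<in> carrier G" using that A by auto
    then show ?thesis using inj_on_eq_iff[OF inj, of "a' \<otimes> inv a" x] x by simp
  qed
  have "{(a, a') \<in> h ` A \<times> h ` A. a' \<otimes>\<^bsub>H\<^esub> inv\<^bsub>H\<^esub> a = h x}
      = map_prod h h ` {(a, a') \<in> A \<times> A. a' \<otimes> inv a = x}"
  proof (intro equalityI subsetI)
    fix p assume "p \<in> {(a, a') \<in> h ` A \<times> h ` A. a' \<otimes>\<^bsub>H\<^esub> inv\<^bsub>H\<^esub> a = h x}"
    then obtain a a' where a: "a \<in> A" "a' \<in> A" "p = (h a, h a')" "h a' \<otimes>\<^bsub>H\<^esub> inv\<^bsub>H\<^esub> h a = h x"
      by auto
    then have "a' \<otimes> inv a = x" using eq by blast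
    then have "(a, a') \<in> {(a, a') \<in> A \<times> A. a' \<otimes> inv a = x}" using a by simp
    then show "p \<in> map_prod h h ` {(a, a') \<in> A \<times> A. a' \<otimes> inv a = x}"
      unfolding a(3) by (rule rev_image_eqI) simp
  next
    fix p assume "p \<in> map_prod h h ` {(a, a') \<in> A \<times> A. a' \<otimes> inv a = x}"
    then obtain a a' where a: "a \<in> A" "a' \<in> A" "p = (h a, h a')" "a' \<otimes> inv a = x"
      by auto
    then have "h a' \<otimes>\<^bsub>H\<^esub> inv\<^bsub>H\<^esub> h a = h x" using eq by blast
    then show "p \<in> {(a, a') \<in> h ` A \<times> h ` A. a' \<otimes>\<^bsub>H\<^esub> inv\<^bsub>H\<^esub> a = h x}"
      using a by simp
  qed
  moreover have "inj_on (map_prod h h) {(a, a') \<in> A \<times> A. a' \<otimes> inv a = x}"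
    by (rule inj_on_subset[OF map_prod_inj_on[OF inj inj]]) (use A in auto)
  ultimately show ?thesis
    unfolding diff_count_def by (simp add: card_image)
qed

end

lemma finprod_hom:
  assumes "comm_group G" "comm_group H" "h \<in> hom G H" "a \<in> {..<n} \<rightarrow> carrier G"
  shows "h (finprod G a {..<n}) = finprod H (\<lambda>i. h (a i)) {..<n::nat}"
proof -
  interpret G: comm_group G by fact
  interpret H: comm_group H by fact
  interpret group_hom G H h using assms(3) by unfold_locales
  show ?thesis
    using assms(4)
  proof (induction n)
    case 0
    show ?case by simp
  next
    case (Suc n)
    have a: "a \<in> {..<n} \<rightarrow> carrier G" "a n \<in> carrier G"
      using Suc.prems by (auto simp: lessThan_Suc)
    then have ha: "(\<lambda>i. h (a i)) \<in> {..<n} \<rightarrow> carrier H" "h (a n) \<in> carrier H"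
      by (auto simp: Pi_iff)
    show ?case
      using a ha Suc.IH by (simp add: lessThan_Suc G.finprod_insert H.finprod_insert G.finprod_closed)
  qed
qed

lemma sum_diff_set_image:
  assumes G: "comm_group G" and H: "comm_group H" and h: "h \<in> hom G H" and B: "B \<subseteq> carrier G"
  shows "sum_diff_set H n m (h ` B) \<subseteq> h ` sum_diff_set G n m B"
proof
  interpret G: comm_group G by fact
  interpret H: comm_group H by fact
  interpret group_hom G H h using h by unfold_locales
  have lift: "\<exists>a'. a' \<in> {..<k} \<rightarrow> B \<and> finprod H a {..<k} = h (finprod G a' {..<k})"
    if a: "a \<in> {..<k} \<rightarrow> h ` B" for a and k :: nat
  proof -
    have "\<forall>i\<in>{..<k}. \<exists>b. b \<in> B \<and> a i = h b" using a by auto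
    then obtain a' where a': "\<forall>i\<in>{..<k}. a' i \<in> B \<and> a i = h (a' i)" by metis
    then have "finprod H a {..<k} = finprod H (\<lambda>i. h (a' i)) {..<k}"
      using B by (intro H.finprod_cong') auto
    also have "\<dots> = h (finprod G a' {..<k})"
      using a' B by (intro finprod_hom[OF G H h, symmetric]) auto
    finally show ?thesis using a' by blast
  qed
  fix w assume "w \<in> sum_diff_set H n m (h ` B)"
  then obtain a b where ab: "a \<in> {..<n} \<rightarrow> h ` B" "b \<in> {..<m} \<rightarrow> h ` B"
    and w: "w = finprod H a {..<n} \<otimes>\<^bsub>H\<^esub> inv\<^bsub>H\<^esub> finprod H b {..<m}"
    by (auto simp: sum_diff_set_def)
  obtain a' b' where a': "a' \<in> {..<n} \<rightarrow> B" "finprod H a {..<n} = h (finprod G a' {..<n})"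
    and b': "b' \<in> {..<m} \<rightarrow> B" "finprod H b {..<m} = h (finprod G b' {..<m})"
    using lift[OF ab(1)] lift[OF ab(2)] by blast
  have "finprod G a' {..<n} \<in> carrier G" "finprod G b' {..<m} \<in> carrier G"
    using a'(1) b'(1) B by (auto intro!: G.finprod_closed)
  then have "w = h (finprod G a' {..<n} \<otimes>\<^bsub>G\<^esub> inv\<^bsub>G\<^esub> finprod G b' {..<m})"
    using w a'(2) b'(2) by simp
  then show "w \<in> h ` sum_diff_set G n m B"
    using a'(1) b'(1) by (auto simp: sum_diff_set_def)
qed

lemma (in comm_group) finite_sum_diff_set:
  assumes "finite B" "B \<subseteq> carrier G"
  shows "finite (sum_diff_set G n m B)"
  using finite_subset[OF sum_diff_set_subset[OF assms(2)]] finite_iterated_sum[OF assms(1)]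
  by (simp add: set_inv_image)

text \<open>\<open>A\<close> and \<open>D\<close> are pulled back along \<open>h\<close>.
  Injectivity preserves all cardinalities, difference counts and the energy, so the same
  \<open>\<eta>\<close> and \<open>M\<close> work in \<open>H\<close>; the subset found there is
  pushed forward.\<close>

lemma structured_subset_transfer:
  fixes \<eta> M :: real
  assumes G: "comm_group G" and H: "comm_group H" and h: "h \<in> hom H G" and inj: "inj_on h (carrier H)"
    and structured: "structured_subsets H c C"
    and A: "A \<subseteq> h ` carrier H" "finite A" "A \<noteq> {}"
    and D: "D \<subseteq> A <#>\<^bsub>G\<^esub> set_inv\<^bsub>G\<^esub> A" "D = set_inv\<^bsub>G\<^esub> D" and \<eta>: "0 < \<eta>" "\<eta> \<le> 1"
    and D_sum: "real (\<Sum>x\<in>D. diff_count G A x) = \<eta> * real (card A) ^ 2"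
    and energy: "real (energy3 G A) = \<eta> ^ 3 * M * real (card A) ^ 6 / real (card D) ^ 2"
  shows "\<exists>A' \<subseteq> A. real (card A') \<ge> c * (\<eta> ^ 16 * real (card A) / M ^ 5) \<and>
    (\<forall>n\<ge>1. \<forall>m\<ge>1. real (card (sum_diff_set G n m A')) \<le>
      C n m * (\<eta> ^ 15 / M ^ 5) powi (- (7 * (int n + int m)))
        * (real (card D) / (\<eta> * real (card A))) * real (card A'))"
proof -
  interpret G: comm_group G by fact
  interpret H: comm_group H by fact
  interpret group_hom H G h using h by unfold_locales
  define A0 where "A0 = {x \<in> carrier H. h x \<in> A}"
  define D0 where "D0 = {x \<in> carrier H. h x \<in> D}"
  have A0: "A0 \<subseteq> carrier H" "A = h ` A0" using A(1) by (auto simp: A0_def)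
  have inj_sub: "inj_on h B" if "B \<subseteq> carrier H" for B using inj that by (rule inj_on_subset)
  have A0_fin: "finite A0" using A(2) A0(2) finite_imageD[OF _ inj_sub[OF A0(1)]] by simp
  define \<Delta> where "\<Delta> = A0 <#>\<^bsub>H\<^esub> set_inv\<^bsub>H\<^esub> A0"
  have \<Delta>: "\<Delta> \<subseteq> carrier H" "A <#>\<^bsub>G\<^esub> set_inv\<^bsub>G\<^esub> A = h ` \<Delta>"
    unfolding \<Delta>_def A0(2)
    by (intro H.set_mult_closed H.set_inv_closed diff_set_image_hom A0(1))+
  \<comment> \<open>As \<open>D\<close> lies in \<open>A - A\<close>, it lies in the image of
    \<open>h\<close>, and pulling back loses no element.\<close>
  have D0: "D0 \<subseteq> carrier H" "D = h ` D0"
    using D(1) \<Delta> by (auto simp: D0_def)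
  have D0_sub: "D0 \<subseteq> \<Delta>"
  proof
    fix x assume "x \<in> D0"
    then have "x \<in> carrier H" "h x \<in> h ` \<Delta>" using D(1) \<Delta>(2) D0 by auto
    then show "x \<in> \<Delta>" using inj_on_image_mem_iff[OF inj _ \<Delta>(1)] by blast
  qed
  have D0_sym: "D0 = set_inv\<^bsub>H\<^esub> D0"
  proof -
    have "h ` D0 = h ` (set_inv\<^bsub>H\<^esub> D0)"
      using D(2) set_inv_image_hom[OF D0(1)] D0(2) by simp
    then show ?thesis
      using inj_on_image_eq_iff[OF inj D0(1) H.set_inv_closed[OF D0(1)]] by blast
  qed
  have dc: "diff_count G A (h x) = diff_count H A0 x" if "x \<in> carrier H" for x
    unfolding A0(2) using that by (intro diff_count_image inj A0(1))
  have card: "card A = card A0" "card D = card D0"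
    unfolding A0(2) D0(2) by (intro card_image inj_sub A0(1) D0(1))+
  have "(\<Sum>x\<in>D. diff_count G A x) = (\<Sum>x\<in>D0. diff_count H A0 x)"
    unfolding D0(2) sum.reindex[OF inj_sub[OF D0(1)]] using D0(1) dc by (intro sum.cong) auto
  then have D_sum': "real (\<Sum>x\<in>D0. diff_count H A0 x) = \<eta> * real (card A0) ^ 2"
    using D_sum card by simp
  have "energy3 G A = (\<Sum>x\<in>h ` \<Delta>. diff_count G A x ^ 3)"
    unfolding \<Delta>(2)[symmetric] using A(2) A0 by (intro G.energy3_eq) auto
  also have "\<dots> = (\<Sum>x\<in>\<Delta>. diff_count H A0 x ^ 3)"
    unfolding sum.reindex[OF inj_sub[OF \<Delta>(1)]] using \<Delta>(1) dc by (intro sum.cong) auto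
  also have "\<dots> = energy3 H A0"
    unfolding \<Delta>_def by (intro H.energy3_eq[symmetric] A0_fin A0(1))
  finally have energy': "real (energy3 H A0) = \<eta> ^ 3 * M * real (card A0) ^ 6 / real (card D0) ^ 2"
    using energy card by simp
  have "A0 \<noteq> {}" using A(3) A0(2) by auto
  then obtain B where B: "B \<subseteq> A0" "real (card B) \<ge> c * (\<eta> ^ 16 * real (card A0) / M ^ 5)"
    and B_sum: "\<forall>n\<ge>1. \<forall>m\<ge>1. real (card (sum_diff_set H n m B)) \<le>
      C n m * (\<eta> ^ 15 / M ^ 5) powi (- (7 * (int n + int m)))
        * (real (card D0) / (\<eta> * real (card A0))) * real (card B)"
    using structured[unfolded structured_subsets_def, rule_format, of A0 D0 \<eta> M]
      A0(1) A0_fin D0_sub[unfolded \<Delta>_def] D0_sym \<eta> D_sum' energy'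
    by blast
  have Bc: "B \<subseteq> carrier H" "finite B" using B(1) A0 A0_fin finite_subset by auto
  have card_B: "card (h ` B) = card B" by (intro card_image inj_sub Bc)
  have "card (sum_diff_set G n m (h ` B)) \<le> card (sum_diff_set H n m B)" for n m
    using sum_diff_set_image[OF H G h Bc(1)] H.finite_sum_diff_set[OF Bc(2,1)]
    by (meson card_image_le card_mono finite_imageI order_trans)
  then have "real (card (sum_diff_set G n m (h ` B))) \<le> real (card (sum_diff_set H n m B))" for n m
    by simp
  then have "\<forall>n\<ge>1. \<forall>m\<ge>1. real (card (sum_diff_set G n m (h ` B))) \<le>
      C n m * (\<eta> ^ 15 / M ^ 5) powi (- (7 * (int n + int m)))
        * (real (card D) / (\<eta> * real (card A))) * real (card (h ` B))"
    using B_sum unfolding card card_B by (meson order_trans)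
  moreover have "h ` B \<subseteq> A" using B(1) A0(2) by auto
  ultimately show ?thesis using B(2) unfolding card card_B[symmetric] by blast
qed

text \<open>Every element of the generated subgroup is the product of a word over the generators and
  their inverses, and there are countably many finite words over a countable alphabet.\<close>

lemma (in group) countable_generate:
  assumes "countable A" "A \<subseteq> carrier G"
  shows "countable (generate G A)"
proof -
  define Y where "Y = A \<union> m_inv G ` A"
  have Y: "countable Y" "Y \<subseteq> carrier G" using assms by (auto simp: Y_def)
  define f where "f = (\<lambda>xs. foldr (\<otimes>) xs \<one>)"
  have f_closed: "f xs \<in> carrier G" if "xs \<in> lists Y" for xs
    using that Y(2) by (induction xs) (auto simp: f_def)
  have f_append: "f (xs @ ys) = f xs \<otimes> f ys" if "xs \<in> lists Y" "ys \<in> lists Y" for xs ys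
    using that(1)
  proof (induction xs)
    case Nil
    then show ?case using f_closed[OF that(2)] by (simp add: f_def)
  next
    case (Cons x xs)
    then show ?case
      using f_closed[OF that(2)] f_closed[of xs] Y(2) by (auto simp: f_def m_assoc)
  qed
  have "generate G A \<subseteq> f ` lists Y"
  proof
    fix x assume "x \<in> generate G A"
    then show "x \<in> f ` lists Y"
    proof (induction rule: generate.induct)
      case one
      then show ?case by (intro image_eqI[of _ _ "[]"]) (auto simp: f_def)
    next
      case (incl a)
      then show ?case using Y by (intro image_eqI[of _ _ "[a]"]) (auto simp: f_def Y_def)
    next
      case (inv a)
      then show ?case using Y by (intro image_eqI[of _ _ "[inv a]"]) (auto simp: f_def Y_def)
    next
      case (eng a b)
      then obtain xs ys where "xs \<in> lists Y" "ys \<in> lists Y" "a = f xs" "b = f ys" by auto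
      then show ?case using f_append by (intro image_eqI[of _ _ "xs @ ys"]) auto
    qed
  qed
  moreover have "countable (f ` lists Y)" using Y by auto
  ultimately show ?thesis by (rule countable_subset)
qed

text \<open>An injection of the generated subgroup into \<open>nat\<close> carries the group
  structure along; its inverse \<open>g\<close> is the embedding back into \<open>G\<close>.\<close>

lemma (in comm_group) nat_copy_of_generated:
  assumes "countable A" "A \<subseteq> carrier G"
  obtains H :: "nat monoid" and h where "comm_group H" "h \<in> hom H G" "inj_on h (carrier H)"
    "A \<subseteq> h ` carrier H"
proof -
  define S where "S = generate G A"
  have S: "subgroup S G" unfolding S_def using assms(2) by (rule generate_is_subgroup)
  have AS: "A \<subseteq> S" by (auto simp: S_def intro: generate.incl)
  have S_car: "S \<subseteq> carrier G" using S by (rule subgroup.subset)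
  have "countable S" unfolding S_def using assms by (rule countable_generate)
  define f where "f = to_nat_on S"
  define g where "g = inv_into S f"
  have inj: "inj_on f S" unfolding f_def using \<open>countable S\<close> by (rule inj_on_to_nat_on)
  have gf: "g (f x) = x" if "x \<in> S" for x using that inj by (simp add: g_def)
  define H where "H = \<lparr>carrier = f ` S, monoid.mult = (\<lambda>u v. f (g u \<otimes> g v)), one = f \<one>\<rparr>"
  have S_ops: "\<one> \<in> S" "\<And>x y. x \<in> S \<Longrightarrow> y \<in> S \<Longrightarrow> x \<otimes> y \<in> S" "\<And>x. x \<in> S \<Longrightarrow> inv x \<in> S"
    using S by (auto intro: subgroup.one_closed subgroup.m_closed subgroup.m_inv_closed)
  have S_mem: "x \<in> carrier G" if "x \<in> S" for x using that S_car by auto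
  have "comm_group H"
  proof (rule comm_groupI)
    fix x assume "x \<in> carrier H"
    then obtain y where y: "y \<in> S" "x = f y" by (auto simp: H_def)
    show "\<exists>y\<in>carrier H. y \<otimes>\<^bsub>H\<^esub> x = \<one>\<^bsub>H\<^esub>"
      by (rule bexI[of _ "f (inv y)"]) (use y S_ops S_mem in \<open>auto simp: H_def gf\<close>)
  qed (auto simp: H_def gf S_ops S_mem m_ac)
  moreover have "g \<in> hom H G"
    by (rule homI) (auto simp: H_def gf S_ops S_mem)
  moreover have "inj_on g (carrier H)"
    by (auto simp: H_def gf intro!: inj_onI)
  moreover have "A \<subseteq> g ` carrier H"
    using AS by (auto simp: H_def gf image_image)
  ultimately show thesis by (rule that)
qed

lemma (in comm_group) structured_subsets_absolute:
  "structured_subsets G (1 / 2 ^ 25) (\<lambda>n m. 2 * 2 ^ (168 * (n + m)))"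
  unfolding structured_subsets_def
proof (intro allI impI, elim conjE)
  fix A D and \<eta> M :: real
  assume A: "A \<subseteq> carrier G" "finite A" "A \<noteq> {}" and D: "D \<subseteq> A <#> set_inv A" "D = set_inv D"
    and \<eta>: "0 < \<eta>" "\<eta> \<le> 1" and D_sum: "real (\<Sum>x\<in>D. diff_count G A x) = \<eta> * real (card A) ^ 2"
    and energy: "real (energy3 G A) = \<eta> ^ 3 * M * real (card A) ^ 6 / real (card D) ^ 2"
  obtain B where "B \<subseteq> A" "1 / 2 ^ 25 * (\<eta> ^ 16 * real (card A) / M ^ 5) \<le> card B"
    "\<And>n m. card (sum_diff_set G n m B) \<le>
      2 * 2 ^ (168 * (n + m)) * (\<eta> ^ 15 / M ^ 5) powi (- (7 * (int n + int m)))
        * (real (card D) / (\<eta> * real (card A))) * real (card B)"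
    using structured_subset[OF A(2,1,3) D \<eta> D_sum[unfolded of_nat_sum] energy] by blast
  then show "\<exists>A'\<subseteq>A. 1 / 2 ^ 25 * (\<eta> ^ 16 * real (card A) / M ^ 5) \<le> real (card A') \<and>
      (\<forall>n\<ge>1. \<forall>m\<ge>1. real (card (sum_diff_set G n m A')) \<le>
        2 * 2 ^ (168 * (n + m)) * (\<eta> ^ 15 / M ^ 5) powi (- (7 * (int n + int m)))
          * (real (card D) / (\<eta> * real (card A))) * real (card A'))"
    by blast
qed

text \<open>The constants are arbitrary but fixed. Each instance concerns one finite
  \<open>A\<close>, whose generated subgroup has a copy on \<open>nat\<close>; the copy depends on
  \<open>A\<close>, the constants do not.\<close>

lemma structured_subsets_from_nat:
  assumes nat: "\<And>H :: nat monoid. comm_group H \<Longrightarrow> structured_subsets H c C" and G: "comm_group G"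
  shows "structured_subsets G c C"
  unfolding structured_subsets_def
proof (intro allI impI, elim conjE)
  interpret comm_group G by fact
  fix A D and \<eta> M :: real
  assume A: "A \<subseteq> carrier G" "finite A" "A \<noteq> {}" and D: "D \<subseteq> A <#>\<^bsub>G\<^esub> set_inv\<^bsub>G\<^esub> A" "D = set_inv\<^bsub>G\<^esub> D"
    and \<eta>: "0 < \<eta>" "\<eta> \<le> 1" and D_sum: "real (\<Sum>x\<in>D. diff_count G A x) = \<eta> * real (card A) ^ 2"
    and energy: "real (energy3 G A) = \<eta> ^ 3 * M * real (card A) ^ 6 / real (card D) ^ 2"
  obtain H :: "nat monoid" and h where H: "comm_group H" "h \<in> hom H G" "inj_on h (carrier H)"
    "A \<subseteq> h ` carrier H"
    using nat_copy_of_generated[OF countable_finite[OF A(2)] A(1)] by blast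
  show "\<exists>A'\<subseteq>A. c * (\<eta> ^ 16 * real (card A) / M ^ 5) \<le> real (card A') \<and>
      (\<forall>n\<ge>1. \<forall>m\<ge>1. real (card (sum_diff_set G n m A')) \<le>
        C n m * (\<eta> ^ 15 / M ^ 5) powi (- (7 * (int n + int m)))
          * (real (card D) / (\<eta> * real (card A))) * real (card A'))"
    by (rule structured_subset_transfer[OF G H(1-3) nat[OF H(1)] H(4) A(2,3) D \<eta> D_sum energy])
qed

theorem theorem57:
  shows
    "(\<exists>c>0. \<exists>C. (\<forall>n\<ge>1. \<forall>m\<ge>1. C n m > 0) \<and>
        (\<forall>G :: nat monoid. comm_group G \<longrightarrow> structured_subsets G c C)) \<and>
     (\<forall>c>0. \<forall>C. (\<forall>n\<ge>1. \<forall>m\<ge>1. C n m > 0) \<and>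
        (\<forall>G :: nat monoid. comm_group G \<longrightarrow> structured_subsets G c C) \<longrightarrow>
        (\<forall>G :: 'a monoid. comm_group G \<longrightarrow> structured_subsets G c C))"
proof
  show "\<exists>c>0. \<exists>C. (\<forall>n\<ge>1. \<forall>m\<ge>1. C n m > 0) \<and>
      (\<forall>G :: nat monoid. comm_group G \<longrightarrow> structured_subsets G c C)"
    by (intro exI[of _ "1 / 2 ^ 25"] exI[of _ "\<lambda>n m. 2 * 2 ^ (168 * (n + m))"] conjI allI impI
        comm_group.structured_subsets_absolute) auto
  \<comment> \<open>Any constants valid on \<open>nat\<close> pass unchanged to the type
    \<open>'a\<close>.\<close>
  show "\<forall>c>0. \<forall>C. (\<forall>n\<ge>1. \<forall>m\<ge>1. C n m > 0) \<and>
      (\<forall>G :: nat monoid. comm_group G \<longrightarrow> structured_subsets G c C) \<longrightarrow>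
      (\<forall>G :: 'a monoid. comm_group G \<longrightarrow> structured_subsets G c C)"
    using structured_subsets_from_nat by blast
qed

end
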